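(* Let $0<\alpha<1$, $\Lambda>0$ be fixed. Then, for each $v_0\in(0,1)$, there exists a unique solution $(c(v_0),R(v_0),v(v_0;\xi))$ to the one-phase free boundary problem $$\begin{cases}\Lambda v''(\xi)-cv'(\xi)=v^\alpha(\xi),\quad 0<\xi<R,\\ v(0)=v_0,\quad v'(0)=-\dfrac{c}{\Lambda}(1-v_0),\\ v(R)=v'(R)=0,\end{cases}$$ such that $c(v_0)>0$, $0<R(v_0)<+\infty$ and $v\in C^\infty([0,R))\cap C^{2+[\beta],\beta-[\beta]}([0,R])$ with $\beta=\dfrac{2\alpha}{1-\alpha}$. Moreover, $$v(\xi)>0,\quad v'(\xi)<0,\quad v''(\xi)>0,\qquad \forall\,\xi\in[0,R).$$
   Context: The unknowns are the real number $c$, the free boundary $R$ and the function $v$ on $[0,R]$, which is nonnegative so that $v^\alpha$ makes sense. $[\beta]$ denotes the integer part of $\beta$, and $C^{k,\gamma}([0,R])$ the space of $k$ times continuously differentiable functions whose $k$-th derivative is Hölder continuous with exponent $\gamma$ (just $C^k$ if $\gamma=0$). *)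

theory Defs
  imports "HOL-Analysis.Analysis"
begin

text \<open>The derivative relative to a set is one-sided at an endpoint belonging to the interval.\<close>

definition deriv_on :: "real set \<Rightarrow> (real \<Rightarrow> real) \<Rightarrow> real \<Rightarrow> real" where
  "deriv_on S f = (\<lambda>x. vector_derivative f (at x within S))"

definition Ck_on :: "nat \<Rightarrow> real set \<Rightarrow> (real \<Rightarrow> real) \<Rightarrow> bool" where
  "Ck_on k S f \<longleftrightarrow>
     (\<forall>j<k. \<forall>x\<in>S. (deriv_on S ^^ j) f differentiable (at x within S)) \<and>
     continuous_on S ((deriv_on S ^^ k) f)"

definition Cinf_on :: "real set \<Rightarrow> (real \<Rightarrow> real) \<Rightarrow> bool" where
  "Cinf_on S f \<longleftrightarrow> (\<forall>k. Ck_on k S f)"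

text \<open>The space \<open>C\<^sup>k\<^sup>,\<^sup>\<gamma>\<close> on a compact interval \<open>S\<close>, with the convention that
  \<open>\<gamma> = 0\<close> imposes no condition beyond \<open>C\<^sup>k\<close>.\<close>

definition Holder_space :: "nat \<Rightarrow> real \<Rightarrow> real set \<Rightarrow> (real \<Rightarrow> real) \<Rightarrow> bool" where
  "Holder_space k \<gamma> S f \<longleftrightarrow>
     Ck_on k S f \<and>
     (\<gamma> \<noteq> 0 \<longrightarrow>
       (\<exists>C. \<forall>x\<in>S. \<forall>y\<in>S.
          \<bar>(deriv_on S ^^ k) f x - (deriv_on S ^^ k) f y\<bar> \<le> C * \<bar>x - y\<bar> powr \<gamma>))"

text \<open>The nonnegativity of \<open>v\<close> is required because \<open>powr\<close> is total but represents
  \<open>v\<^sup>\<alpha>\<close> only for nonnegative \<open>v\<close>. Likewise \<open>deriv_on\<close> is total: the equations are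
  meaningful together with the regularity demanded in \<open>fb_solution\<close> below, which always
  includes \<open>C\<^sup>2\<close> on the closed interval.\<close>

definition fb_problem ::
    "real \<Rightarrow> real \<Rightarrow> real \<Rightarrow> real \<Rightarrow> real \<Rightarrow> (real \<Rightarrow> real) \<Rightarrow> bool" where
  "fb_problem \<alpha> \<Lambda> v0 c R v \<longleftrightarrow>
     (let v' = deriv_on {0..R} v; v'' = deriv_on {0..R} v' in
       (\<forall>\<xi>\<in>{0..R}. 0 \<le> v \<xi>) \<and>
       (\<forall>\<xi>\<in>{0<..<R}. \<Lambda> * v'' \<xi> - c * v' \<xi> = v \<xi> powr \<alpha>) \<and>
       v 0 = v0 \<and> v' 0 = - (c / \<Lambda>) * (1 - v0) \<and>
       v R = 0 \<and> v' R = 0)"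

definition fb_solution ::
    "real \<Rightarrow> real \<Rightarrow> real \<Rightarrow> real \<Rightarrow> real \<Rightarrow> (real \<Rightarrow> real) \<Rightarrow> bool" where
  "fb_solution \<alpha> \<Lambda> v0 c R v \<longleftrightarrow>
     fb_problem \<alpha> \<Lambda> v0 c R v \<and> 0 < c \<and> 0 < R \<and>
     Cinf_on {0..<R} v \<and>
     (let \<beta> = 2 * \<alpha> / (1 - \<alpha>) in
       Holder_space (2 + nat \<lfloor>\<beta>\<rfloor>) (\<beta> - of_int \<lfloor>\<beta>\<rfloor>) {0..R} v)"

end

theory Submission imports Defs begin

text \<open>With \<open>\<mu> = c / \<Lambda>\<close> and \<open>lam\<close> given by \<open>lam c\<^sup>2 = \<Lambda> lam\<^sup>\<alpha>\<close>, every solution has the form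
  \<open>v(\<xi>) = lam Z(\<mu> (R - \<xi>))\<close>, where \<open>Z'' + Z' = Z\<^sup>\<alpha>\<close> and \<open>Z(0) = Z'(0) = 0\<close>: a single
  initial value problem, independent of all the data. It has exactly one positive solution
  \<open>U\<close>. Existence is by monotone iteration between multiples of \<open>s\<^sup>p\<close>, \<open>p = 2 / (1 - \<alpha>)\<close>, and
  uniqueness by comparison, since the nonlinearity is sublinear. A nonnegative solution is
  \<open>U\<close> preceded by an interval on which it vanishes; the interval is empty because \<open>v\<close>
  would otherwise be \<open>C\<^sup>\<infinity>\<close> and flat at an interior point where \<open>U \<sim> A s\<^sup>p\<close>.

  The boundary conditions at \<open>\<xi> = 0\<close> become \<open>lam U(\<tau>) = v0\<close> and \<open>lam U'(\<tau>) = 1 - v0\<close> with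
  \<open>\<tau> = \<mu> R\<close>, hence \<open>U'(\<tau>) / U(\<tau>) = (1 - v0) / v0\<close>. As \<open>U' / U\<close> decreases strictly from
  \<open>\<infinity>\<close> to \<open>0\<close>, this determines \<open>\<tau>\<close>, then \<open>lam\<close>, \<open>c\<close> and \<open>R\<close>. The regularity at the free
  boundary follows since \<open>U \<sim> A s\<^sup>p\<close> may be differentiated any number of times.\<close>

section \<open>The profile: existence\<close>

locale sublinear =
  fixes \<alpha> :: real
  assumes \<alpha>_pos: "0 < \<alpha>" and \<alpha>_less: "\<alpha> < 1"
begin

text \<open>The exponent fixed by \<open>p - 2 = p * \<alpha>\<close>, which balances
  \<open>Z''\<close> with the power of \<open>Z\<close>. It equals 2 + \<beta>, so the regularity
  claimed at the free boundary is that of the pure power.\<close>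

definition p :: real where "p = 2 / (1 - \<alpha>)"

text \<open>\<open>A s\<^sup>p\<close> solves \<open>Z'' = Z\<^sup>\<alpha>\<close>, which is the leading behaviour at the free boundary.\<close>

definition A :: real where "A = (1 / (p * (p - 1))) powr (p / 2)"

lemma p_gt_2: "p > 2"
  using \<alpha>_pos \<alpha>_less by (simp add: p_def field_simps)

lemma p_mult_\<alpha>: "p * \<alpha> = p - 2" "\<alpha> * p = p - 2"
  using \<alpha>_less by (simp_all add: p_def field_simps)

lemma A_pos: "A > 0"
  using p_gt_2 by (simp add: A_def)

text \<open>By \<open>p * \<alpha> / 2 = p / 2 - 1\<close>. This is the matching of coefficients
  when \<open>A * s powr p\<close> is put into \<open>Z'' = Z powr \<alpha>\<close>.\<close>

lemma A_powr: "A powr \<alpha> = A * (p * (p - 1))"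
proof -
  have "A powr \<alpha> = (1 / (p * (p - 1))) powr (p / 2 - 1)"
    using p_mult_\<alpha> by (simp add: A_def powr_powr diff_divide_distrib)
  also have "\<dots> = A * (p * (p - 1))"
    using p_gt_2 by (simp add: A_def powr_diff)
  finally show ?thesis .
qed

text \<open>The fixed points of \<open>T\<close> are the solutions of \<open>Z'' + Z' = Z\<^sup>\<alpha>\<close> with
  \<open>Z(0) = Z'(0) = 0\<close>. The iteration from the supersolution decreases, and the subsolution
  keeps the limit away from the trivial fixed point 0.\<close>

definition T :: "(real \<Rightarrow> real) \<Rightarrow> real \<Rightarrow> real" where
  "T f s = integral {0..s} (\<lambda>t. (1 - exp (t - s)) * f t powr \<alpha>)"

definition super :: "real \<Rightarrow> real" where "super s = A * s powr p"

text \<open>The exponential factor pays for the damping term and tends to 1 at 0, so both barriers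
  have the same leading coefficient \<open>A\<close> and pin down the asymptotics of anything
  between them.\<close>

definition sub :: "real \<Rightarrow> real" where "sub s = exp (- s * p / 2) * super s"

definition u :: "nat \<Rightarrow> real \<Rightarrow> real" where "u n = (T ^^ n) super"

lemma u_0: "u 0 = super" and u_Suc: "u (Suc n) = T (u n)"
  by (simp_all add: u_def)

section \<open>Continuity and monotonicity of the integral operator\<close>

lemma continuous_on_powr_\<alpha>:
  assumes "continuous_on S f" "\<And>t. t \<in> S \<Longrightarrow> (0::real) \<le> f t"
  shows "continuous_on S (\<lambda>t. f t powr \<alpha>)"
  using assms \<alpha>_pos by (intro continuous_on_powr') auto

lemma super_continuous: "continuous_on {0..b} super"
  unfolding super_def using p_gt_2 by (intro continuous_intros continuous_on_powr') auto

lemma sub_continuous: "continuous_on {0..b} sub"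
  unfolding sub_def by (intro continuous_intros super_continuous) auto

lemma sub_nonneg: "0 \<le> sub s"
  using A_pos by (simp add: sub_def super_def)

lemma sub_le_super: "0 \<le> s \<Longrightarrow> sub s \<le> super s"
  using A_pos p_gt_2 unfolding sub_def super_def
  by (intro mult_left_le_one_le) auto

lemma continuous_imp_integrable_kernel:
  fixes f k :: "real \<Rightarrow> real"
  assumes "continuous_on {0..s} f" "\<And>t. t \<in> {0..s} \<Longrightarrow> 0 \<le> f t" "continuous_on {0..s} k"
  shows "(\<lambda>t. k t * f t powr \<alpha>) integrable_on {0..s}"
  using assms(2)
  by (intro integrable_continuous_interval continuous_on_mult assms continuous_on_powr_\<alpha>)

lemma T_mono:
  assumes "continuous_on {0..s} f" "continuous_on {0..s} g"
    and "\<And>t. t \<in> {0..s} \<Longrightarrow> 0 \<le> f t" "\<And>t. t \<in> {0..s} \<Longrightarrow> f t \<le> g t"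
  shows "T f s \<le> T g s"
  unfolding T_def
proof (rule integral_le)
  have "0 \<le> g t" if "t \<in> {0..s}" for t
    using assms(3,4) that by (meson order_trans)
  then show "(\<lambda>t. (1 - exp (t - s)) * g t powr \<alpha>) integrable_on {0..s}"
    using assms by (intro continuous_imp_integrable_kernel continuous_intros) auto
  show "(\<lambda>t. (1 - exp (t - s)) * f t powr \<alpha>) integrable_on {0..s}"
    using assms by (intro continuous_imp_integrable_kernel continuous_intros) auto
  show "(1 - exp (t - s)) * f t powr \<alpha> \<le> (1 - exp (t - s)) * g t powr \<alpha>" if "t \<in> {0..s}" for t
    using assms(3,4) that \<alpha>_pos by (intro mult_left_mono powr_mono2) auto
qed

text \<open>Writing \<open>exp (t - s)\<close> as \<open>exp (- s) * exp t\<close> leaves indefinite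
  integrals whose integrands do not depend on \<open>s\<close>; continuity and differentiability in
  \<open>s\<close> are read off from these.\<close>

lemma kernel_split:
  fixes h :: "real \<Rightarrow> real"
  assumes "(\<lambda>t. h t) integrable_on {0..s}" "(\<lambda>t. exp t * h t) integrable_on {0..s}"
  shows "integral {0..s} (\<lambda>t. (1 - exp (t - s)) * h t) =
    integral {0..s} h - exp (- s) * integral {0..s} (\<lambda>t. exp t * h t)"
proof -
  have "(1 - exp (t - s)) * h t = h t - exp (- s) * (exp t * h t)" for t
    by (simp add: exp_diff exp_minus field_simps)
  then have "integral {0..s} (\<lambda>t. (1 - exp (t - s)) * h t) =
      integral {0..s} (\<lambda>t. h t - exp (- s) * (exp t * h t))"
    by simp
  also have "\<dots> = integral {0..s} h - integral {0..s} (\<lambda>t. exp (- s) * (exp t * h t))"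
    using assms by (intro integral_diff integrable_on_mult_right) auto
  finally show ?thesis by simp
qed

lemma kernel_continuous:
  fixes h :: "real \<Rightarrow> real"
  assumes "h integrable_on {0..b}" "(\<lambda>t. exp t * h t) integrable_on {0..b::real}"
  shows "continuous_on {0..b} (\<lambda>s. integral {0..s} (\<lambda>t. (1 - exp (t - s)) * h t))"
proof -
  have "continuous_on {0..b}
      (\<lambda>s. integral {0..s} h - exp (- s) * integral {0..s} (\<lambda>t. exp t * h t))"
    using assms by (intro continuous_intros indefinite_integral_continuous_1)
  then show ?thesis
  proof (rule continuous_on_eq)
    fix s assume "s \<in> {0..b}"
    then show "integral {0..s} h - exp (- s) * integral {0..s} (\<lambda>t. exp t * h t) =
        integral {0..s} (\<lambda>t. (1 - exp (t - s)) * h t)"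
      using assms by (subst kernel_split) (auto intro: integrable_on_subinterval)
  qed
qed

lemma T_continuous:
  assumes "continuous_on {0..b} f" "\<And>t. t \<in> {0..b} \<Longrightarrow> 0 \<le> f t"
  shows "continuous_on {0..b} (T f)"
  using kernel_continuous[of "\<lambda>t. f t powr \<alpha>" b]
    continuous_imp_integrable_kernel[OF assms, where k = "\<lambda>_. 1"]
    continuous_imp_integrable_kernel[OF assms, where k = exp]
  by (simp add: T_def[abs_def] continuous_on_exp continuous_on_id)

section \<open>The supersolution and the subsolution\<close>

lemma integral_power_kernel:
  assumes "0 \<le> s"
  shows "((\<lambda>t. (s - t) * t powr (p - 2)) has_integral s powr p / (p * (p - 1))) {0..s}"
proof -
  have "((\<lambda>t. (s - t) * t powr (p - 2)) has_integral
     (s * s powr (p - 1) / (p - 1) - s powr p / p) - (s * 0 powr (p - 1) / (p - 1) - 0 powr p / p)) {0..s}"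
  proof (rule fundamental_theorem_of_calculus_interior[OF assms])
    show "continuous_on {0..s} (\<lambda>t. s * t powr (p - 1) / (p - 1) - t powr p / p)"
      using p_gt_2 by (intro continuous_intros continuous_on_powr') auto
    fix t assume t: "t \<in> {0<..<s}"
    have "((\<lambda>t. s * t powr (p - 1) / (p - 1) - t powr p / p) has_real_derivative
       s * ((p - 1) * t powr (p - 1 - 1)) / (p - 1) - p * t powr (p - 1) / p) (at t)"
      using t by (intro DERIV_diff DERIV_cdivide DERIV_cmult has_real_derivative_powr) auto
    then have "((\<lambda>t. s * t powr (p - 1) / (p - 1) - t powr p / p) has_real_derivative
       s * t powr (p - 2) - t powr (p - 1)) (at t)"
      using p_gt_2 by simp
    moreover have "t powr (p - 1) = t * t powr (p - 2)"
      using t powr_add[of t 1 "p - 2"] by simp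
    ultimately show "((\<lambda>t. s * t powr (p - 1) / (p - 1) - t powr p / p) has_vector_derivative
       (s - t) * t powr (p - 2)) (at t)"
      by (simp add: has_real_derivative_iff_has_vector_derivative algebra_simps)
  qed
  moreover have "s * s powr (p - 1) = s powr p"
    using powr_mult_base[OF assms, of "p - 1"] by simp
  moreover have "s powr p / (p - 1) - s powr p / p = s powr p / (p * (p - 1))"
    using p_gt_2 by (simp add: field_simps)
  ultimately show ?thesis by simp
qed

lemma super_powr: "0 \<le> t \<Longrightarrow> super t powr \<alpha> = A * (p * (p - 1)) * t powr (p - 2)"
  using A_pos by (simp add: super_def powr_mult powr_powr p_mult_\<alpha> A_powr)

text \<open>Since \<open>1 - exp (- x) \<le> x\<close>, the kernel is bounded by
  \<open>s - t\<close>, the kernel of \<open>Z''\<close> alone, and for that kernel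
  \<open>super\<close> is an exact fixed point.\<close>

lemma T_super_le:
  assumes "0 \<le> s" shows "T super s \<le> super s"
proof -
  have i: "((\<lambda>t. A * (p * (p - 1)) * ((s - t) * t powr (p - 2))) has_integral
      A * (p * (p - 1)) * (s powr p / (p * (p - 1)))) {0..s}"
    by (rule has_integral_mult_right[OF integral_power_kernel[OF assms]])
  have "(\<lambda>t. (1 - exp (t - s)) * super t powr \<alpha>) integrable_on {0..s}"
    using sub_nonneg sub_le_super
    by (intro continuous_imp_integrable_kernel super_continuous continuous_intros)
      (auto intro: order_trans)
  then have "T super s \<le> integral {0..s} (\<lambda>t. A * (p * (p - 1)) * ((s - t) * t powr (p - 2)))"
    unfolding T_def
  proof (rule integral_le)
    show "(\<lambda>t. A * (p * (p - 1)) * ((s - t) * t powr (p - 2))) integrable_on {0..s}"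
      using i by blast
    fix t assume t: "t \<in> {0..s}"
    have "1 - exp (t - s) \<le> s - t"
      using exp_ge_add_one_self[of "t - s"] by linarith
    then have "(1 - exp (t - s)) * (A * (p * (p - 1)) * t powr (p - 2)) \<le>
        (s - t) * (A * (p * (p - 1)) * t powr (p - 2))"
      using A_pos p_gt_2 by (intro mult_right_mono) auto
    then show "(1 - exp (t - s)) * super t powr \<alpha> \<le> A * (p * (p - 1)) * ((s - t) * t powr (p - 2))"
      using t by (simp add: super_powr mult_ac)
  qed
  also have "\<dots> = super s"
    unfolding integral_unique[OF i] using p_gt_2 by (simp add: super_def)
  finally show ?thesis .
qed

text \<open>With \<open>x = s - t\<close>, the kernel is at least \<open>x * exp (- x)\<close>. The
  two exponentials, from this bound and from \<open>sub t powr \<alpha>\<close>, together dominate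
  the factor \<open>exp (- s * p / 2)\<close> of \<open>sub s\<close>, and the remaining integral is
  the one solved by \<open>super\<close>.\<close>

lemma sub_le_T_sub:
  assumes "0 \<le> s" shows "sub s \<le> T sub s"
proof -
  let ?c = "exp (- s * p / 2) * (A * (p * (p - 1)))"
  have i: "((\<lambda>t. ?c * ((s - t) * t powr (p - 2))) has_integral
      ?c * (s powr p / (p * (p - 1)))) {0..s}"
    by (rule has_integral_mult_right[OF integral_power_kernel[OF assms]])
  have "sub s = integral {0..s} (\<lambda>t. ?c * ((s - t) * t powr (p - 2)))"
    unfolding integral_unique[OF i] using p_gt_2 by (simp add: sub_def super_def)
  also have "\<dots> \<le> T sub s"
    unfolding T_def
  proof (rule integral_le)
    show "(\<lambda>t. ?c * ((s - t) * t powr (p - 2))) integrable_on {0..s}"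
      using i by blast
    show "(\<lambda>t. (1 - exp (t - s)) * sub t powr \<alpha>) integrable_on {0..s}"
      using sub_nonneg by (intro continuous_imp_integrable_kernel sub_continuous continuous_intros)
    fix t assume t: "t \<in> {0..s}"
    have sub_powr: "sub t powr \<alpha> = exp (- t * (p - 2) / 2) * (A * (p * (p - 1)) * t powr (p - 2))"
    proof -
      have "sub t powr \<alpha> = exp (- t * p / 2) powr \<alpha> * super t powr \<alpha>"
        unfolding sub_def using A_pos by (intro powr_mult) 
      moreover have "exp (- t * p / 2) powr \<alpha> = exp (- t * (p * \<alpha>) / 2)"
        by (simp add: powr_def mult_ac)
      ultimately show ?thesis using t by (simp add: super_powr p_mult_\<alpha>)
    qed
    have "exp (- s * p / 2) \<le> exp (t - s) * exp (- t * (p - 2) / 2)"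
    proof -
      have "t * (p - 2) \<le> s * (p - 2)"
        using t p_gt_2 by (intro mult_right_mono) auto
      then have "- s * p / 2 \<le> (t - s) + (- t * (p - 2) / 2)"
        using t by (simp add: field_simps)
      then show ?thesis by (simp add: exp_add[symmetric])
    qed
    from mult_right_mono[OF this, of "s - t"] t
    have "exp (- s * p / 2) * (s - t) \<le> exp (t - s) * (s - t) * exp (- t * (p - 2) / 2)"
      by (simp add: mult_ac)
    also have "exp (t - s) * (s - t) \<le> 1 - exp (t - s)"
    proof -
      have "exp (t - s) * (1 + (s - t)) \<le> exp (t - s) * exp (s - t)"
        by (intro mult_left_mono exp_ge_add_one_self) auto
      then show ?thesis by (simp add: exp_add[symmetric] algebra_simps)
    qed
    finally have "exp (- s * p / 2) * (s - t) \<le> (1 - exp (t - s)) * exp (- t * (p - 2) / 2)"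
      by simp
    then have "exp (- s * p / 2) * (s - t) * (A * (p * (p - 1)) * t powr (p - 2)) \<le>
        (1 - exp (t - s)) * exp (- t * (p - 2) / 2) * (A * (p * (p - 1)) * t powr (p - 2))"
      using A_pos p_gt_2 by (intro mult_right_mono) auto
    then show "?c * ((s - t) * t powr (p - 2)) \<le> (1 - exp (t - s)) * sub t powr \<alpha>"
      unfolding sub_powr by (simp add: mult_ac)
  qed
  finally show ?thesis .
qed

text \<open>One induction carries continuity, the lower bound and the decrease together, since
  monotonicity of \<open>T\<close> can be used only for continuous nonnegative iterates.\<close>

lemma u_props:
  "continuous_on {0..b} (u n) \<and> (\<forall>s\<ge>0. sub s \<le> u n s \<and> u (Suc n) s \<le> u n s)"
proof (induction n arbitrary: b)
  case 0
  show ?case using super_continuous sub_le_super T_super_le by (simp add: u_0 u_Suc)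
next
  case (Suc n)
  have nonneg: "0 \<le> u n t" if "t \<ge> 0" for t
    using Suc[of 0] that order_trans[OF sub_nonneg[of t]] by simp
  have cont: "continuous_on {0..b} (u (Suc n))" for b
    unfolding u_Suc using Suc nonneg by (intro T_continuous) auto
  have sub: "sub s \<le> u (Suc n) s" if "s \<ge> 0" for s
  proof -
    have "sub s \<le> T sub s" using sub_le_T_sub that .
    also have "\<dots> \<le> T (u n) s"
      using Suc sub_nonneg by (intro T_mono sub_continuous) auto
    finally show ?thesis by (simp add: u_Suc)
  qed
  have "0 \<le> u (Suc n) t" if "t \<ge> 0" for t
    using order_trans[OF sub_nonneg sub] that .
  then have "T (u (Suc n)) s \<le> T (u n) s" if "s \<ge> 0" for s
    using Suc cont that by (intro T_mono) auto
  then have "u (Suc (Suc n)) s \<le> u (Suc n) s" if "s \<ge> 0" for s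
    using that by (simp add: u_Suc)
  with cont sub show ?case by blast
qed

section \<open>The limit of the iteration\<close>

definition U :: "real \<Rightarrow> real" where "U s = lim (\<lambda>n. u n s)"

lemma u_continuous: "continuous_on {0..b} (u n)"
  using u_props by blast

lemma sub_le_u: "0 \<le> s \<Longrightarrow> sub s \<le> u n s"
  using u_props by blast

lemma u_nonneg: "0 \<le> s \<Longrightarrow> 0 \<le> u n s"
  using sub_le_u sub_nonneg order_trans by blast

lemma u_le_super: "0 \<le> s \<Longrightarrow> u n s \<le> super s"
proof (induction n)
  case (Suc n)
  then show ?case using u_props order_trans by blast
qed (simp add: u_0)

lemma u_tendsto_U:
  assumes "0 \<le> s" shows "(\<lambda>n. u n s) \<longlonglongrightarrow> U s"
proof -
  have "decseq (\<lambda>n. u n s)"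
    using u_props assms by (intro decseq_SucI) blast
  then obtain L where "(\<lambda>n. u n s) \<longlonglongrightarrow> L"
    using decseq_convergent u_nonneg[OF assms] by metis
  then show ?thesis by (simp add: U_def limI)
qed

lemma sub_le_U: "0 \<le> s \<Longrightarrow> sub s \<le> U s"
  using u_tendsto_U sub_le_u by (metis Lim_bounded2)

lemma U_le_super: "0 \<le> s \<Longrightarrow> U s \<le> super s"
  using u_tendsto_U u_le_super by (metis Lim_bounded)

lemma U_nonneg: "0 \<le> s \<Longrightarrow> 0 \<le> U s"
  using sub_le_U sub_nonneg order_trans by blast

lemma U_pos: "0 < s \<Longrightarrow> 0 < U s"
  using sub_le_U[of s] A_pos
  by (intro less_le_trans[of 0 "sub s" "U s"]) (auto simp: sub_def super_def)

text \<open>Dominated convergence with majorant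
  \<open>\<bar>k t\<bar> * super t powr \<alpha>\<close>. It yields integrability before continuity
  of \<open>U\<close> is known. The weight \<open>k\<close> is general because the kernel of
  \<open>T\<close> and its two pieces, 1 and \<open>exp\<close>, all occur.\<close>

lemma kernel_convergence:
  assumes "continuous_on {0..s} k"
  shows "(\<lambda>t. k t * U t powr \<alpha>) integrable_on {0..s}"
    and "(\<lambda>n. integral {0..s} (\<lambda>t. k t * u n t powr \<alpha>)) \<longlonglongrightarrow>
       integral {0..s} (\<lambda>t. k t * U t powr \<alpha>)"
proof -
  have 1: "(\<lambda>t. k t * u n t powr \<alpha>) integrable_on {0..s}" for n
    using assms u_continuous u_nonneg by (intro continuous_imp_integrable_kernel) auto
  have 2: "(\<lambda>t. \<bar>k t\<bar> * super t powr \<alpha>) integrable_on {0..s}"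
    using assms u_continuous[of s 0] u_nonneg[of _ 0]
    by (intro continuous_imp_integrable_kernel continuous_intros) (auto simp: u_0)
  have 3: "norm (k t * u n t powr \<alpha>) \<le> \<bar>k t\<bar> * super t powr \<alpha>" if "t \<in> {0..s}" for n t
    using that u_nonneg u_le_super \<alpha>_pos
    by (auto simp: abs_mult intro!: mult_left_mono powr_mono2)
  have 4: "(\<lambda>n. k t * u n t powr \<alpha>) \<longlonglongrightarrow> k t * U t powr \<alpha>" if "t \<in> {0..s}" for t
    using that u_tendsto_U u_nonneg \<alpha>_pos
    by (intro tendsto_intros tendsto_powr') auto
  show "(\<lambda>t. k t * U t powr \<alpha>) integrable_on {0..s}"
    and "(\<lambda>n. integral {0..s} (\<lambda>t. k t * u n t powr \<alpha>)) \<longlonglongrightarrow>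
       integral {0..s} (\<lambda>t. k t * U t powr \<alpha>)"
    using dominated_convergence[OF 1 2 3 4] by auto
qed

lemma U_fixpoint:
  assumes "0 \<le> s" shows "U s = T U s"
proof -
  have "(\<lambda>n. u (Suc n) s) \<longlonglongrightarrow> T U s"
    unfolding u_Suc T_def by (intro kernel_convergence continuous_intros)
  moreover have "(\<lambda>n. u (Suc n) s) \<longlonglongrightarrow> U s"
    using u_tendsto_U[OF assms] by (rule LIMSEQ_Suc)
  ultimately show ?thesis using LIMSEQ_unique by blast
qed

lemma U_0: "U 0 = 0"
  using U_fixpoint[of 0] by (simp add: T_def)

section \<open>The differential equation for the limit\<close>

lemma U_split:
  assumes "0 \<le> s"
  shows "U s = integral {0..s} (\<lambda>t. U t powr \<alpha>)
    - exp (- s) * integral {0..s} (\<lambda>t. exp t * U t powr \<alpha>)"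
  using U_fixpoint[OF assms] kernel_convergence(1)[of s "\<lambda>_. 1"] kernel_convergence(1)[of s exp]
  by (simp add: T_def kernel_split continuous_intros)

lemma U_continuous: "continuous_on {0..b} U"
  using kernel_continuous[of "\<lambda>t. U t powr \<alpha>" b] U_fixpoint
    kernel_convergence(1)[of b "\<lambda>_. 1"] kernel_convergence(1)[of b exp]
  by (auto simp: T_def continuous_intros elim!: continuous_on_eq)

text \<open>The derivative of \<open>U\<close>, in the form given by variation of constants for
  \<open>V' + V = U powr \<alpha>\<close> with \<open>V 0 = 0\<close>.\<close>

definition V :: "real \<Rightarrow> real" where
  "V s = exp (- s) * integral {0..s} (\<lambda>t. exp t * U t powr \<alpha>)"

lemma V_0: "V 0 = 0"
  by (simp add: V_def)

lemma U_powr_continuous: "continuous_on {0..b} (\<lambda>t. U t powr \<alpha>)"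
  using U_continuous U_nonneg by (intro continuous_on_powr_\<alpha>) auto

lemma V_continuous: "continuous_on {0..b} V"
  unfolding V_def
  by (intro continuous_intros indefinite_integral_continuous_1 kernel_convergence)

lemma integral_DERIV:
  assumes "\<And>b. continuous_on {0..b} g" "0 < s"
  shows "((\<lambda>x. integral {0..x} g) has_real_derivative g s) (at s)"
proof -
  have "((\<lambda>x. integral {0..x} g) has_real_derivative g s) (at s within {0..s + 1})"
    using assms by (intro integral_has_real_derivative) auto
  moreover have "at s within {0..s + 1} = at s"
    using assms by (intro at_within_interior) auto
  ultimately show ?thesis by simp
qed

lemma DERIV_V:
  assumes "0 < s" shows "(V has_real_derivative U s powr \<alpha> - V s) (at s)"
proof -
  have "((\<lambda>x. integral {0..x} (\<lambda>t. exp t * U t powr \<alpha>)) has_real_derivative exp s * U s powr \<alpha>) (at s)"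
    using assms by (intro integral_DERIV continuous_intros U_powr_continuous)
  then show ?thesis unfolding V_def
    by (auto intro!: derivative_eq_intros simp: exp_minus field_simps)
qed

text \<open>By \<open>U_split\<close>, \<open>U\<close> is the integral of
  \<open>U powr \<alpha>\<close> minus \<open>V\<close>; differentiating, the power cancels and
  \<open>V\<close> remains.\<close>

lemma DERIV_U:
  assumes "0 < s" shows "(U has_real_derivative V s) (at s)"
proof -
  have "((\<lambda>x. integral {0..x} (\<lambda>t. U t powr \<alpha>) - V x) has_real_derivative
      U s powr \<alpha> - (U s powr \<alpha> - V s)) (at s)"
    using assms by (intro DERIV_diff integral_DERIV DERIV_V U_powr_continuous)
  then have "((\<lambda>x. integral {0..x} (\<lambda>t. U t powr \<alpha>) - V x) has_real_derivative V s) (at s)"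
    by simp
  then show ?thesis
    by (rule has_field_derivative_transform_within_open[where S = "{0<..}"])
      (use assms U_split in \<open>auto simp: V_def\<close>)
qed

end

section \<open>The profile: uniqueness and monotonicity of the logarithmic derivative\<close>

text \<open>The integrating factor \<open>exp s\<close> turns \<open>f' + f\<close> into the
  derivative of \<open>exp s * f s\<close>, up to a positive factor. Every comparison for the damped
  equation below goes through this lemma or its strict version.\<close>

lemma damped_nonneg:
  fixes f f' :: "real \<Rightarrow> real"
  assumes "a \<le> b" "continuous_on {a..b} f" "0 \<le> f a"
    and "\<And>s. a < s \<Longrightarrow> s < b \<Longrightarrow> (f has_real_derivative f' s) (at s)"
    and "\<And>s. a < s \<Longrightarrow> s < b \<Longrightarrow> 0 \<le> f' s + f s"
  shows "0 \<le> f b"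
proof -
  have "exp a * f a \<le> exp b * f b"
  proof (rule DERIV_nonneg_imp_increasing_open[OF assms(1)])
    show "continuous_on {a..b} (\<lambda>s. exp s * f s)"
      by (intro continuous_intros assms)
    fix s assume s: "a < s" "s < b"
    have "((\<lambda>s. exp s * f s) has_real_derivative exp s * (f' s + f s)) (at s)"
      using s by (auto intro!: derivative_eq_intros assms simp: algebra_simps)
    then show "\<exists>y. ((\<lambda>s. exp s * f s) has_real_derivative y) (at s) \<and> 0 \<le> y"
      using assms(5)[OF s] by (intro exI[of _ "exp s * (f' s + f s)"] conjI) auto
  qed
  moreover have "0 \<le> exp a * f a" using assms(3) by simp
  ultimately have "0 \<le> exp b * f b" by linarith
  then show ?thesis by (simp add: zero_le_mult_iff)
qed

lemma damped_pos:
  fixes f f' :: "real \<Rightarrow> real"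
  assumes "a < b" "continuous_on {a..b} f" "0 \<le> f a"
    and "\<And>s. a < s \<Longrightarrow> s < b \<Longrightarrow> (f has_real_derivative f' s) (at s)"
    and "\<And>s. a < s \<Longrightarrow> s < b \<Longrightarrow> 0 < f' s + f s"
  shows "0 < f b"
proof -
  have "exp a * f a < exp b * f b"
  proof (rule DERIV_pos_imp_increasing_open[OF assms(1)])
    show "continuous_on {a..b} (\<lambda>s. exp s * f s)"
      by (intro continuous_intros assms)
    fix s assume s: "a < s" "s < b"
    have "((\<lambda>s. exp s * f s) has_real_derivative exp s * (f' s + f s)) (at s)"
      using s by (auto intro!: derivative_eq_intros assms simp: algebra_simps)
    then show "\<exists>y. ((\<lambda>s. exp s * f s) has_real_derivative y) (at s) \<and> 0 < y"
      using assms(5)[OF s] by (intro exI[of _ "exp s * (f' s + f s)"] conjI) auto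
  qed
  moreover have "0 \<le> exp a * f a" using assms(3) by simp
  ultimately have "0 < exp b * f b" by linarith
  then show ?thesis by (simp add: zero_less_mult_iff)
qed

section \<open>Uniqueness of the positive profile\<close>

context sublinear
begin

text \<open>The equation as a first-order system, satisfied in the interior and continuous up to
  both ends. Solutions vanishing on an initial interval are included; \<open>pos_sol\<close>
  excludes them.\<close>

definition sol :: "real \<Rightarrow> (real \<Rightarrow> real) \<Rightarrow> (real \<Rightarrow> real) \<Rightarrow> bool" where
  "sol S Z Z' \<longleftrightarrow> Z 0 = 0 \<and> Z' 0 = 0 \<and>
     continuous_on {0..S} Z \<and> continuous_on {0..S} Z' \<and>
     (\<forall>s\<in>{0<..<S}. (Z has_real_derivative Z' s) (at s) \<and>
        (Z' has_real_derivative Z s powr \<alpha> - Z' s) (at s))"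

definition pos_sol :: "real \<Rightarrow> (real \<Rightarrow> real) \<Rightarrow> (real \<Rightarrow> real) \<Rightarrow> bool" where
  "pos_sol S Z Z' \<longleftrightarrow> sol S Z Z' \<and> (\<forall>s\<in>{0<..<S}. 0 < Z s)"

lemma pos_sol_imp_sol: "pos_sol S Z Z' \<Longrightarrow> sol S Z Z'"
  by (simp add: pos_sol_def)

lemma pos_sol_U: "pos_sol S U V"
  using U_0 V_0 U_continuous V_continuous U_pos DERIV_U DERIV_V by (simp add: pos_sol_def sol_def)

text \<open>The sum of \<open>Z'\<close> and its derivative is \<open>Z s powr \<alpha>\<close>, and
  values of \<open>powr\<close> are nonnegative.\<close>

lemma sol_deriv_nonneg:
  assumes "sol S Z Z'" "0 \<le> s" "s \<le> S"
  shows "0 \<le> Z' s"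
  using assms
  by (intro damped_nonneg[of 0 s Z' "\<lambda>s. Z s powr \<alpha> - Z' s"])
    (auto simp: sol_def intro: continuous_on_subset)

lemma sol_mono:
  assumes Z: "sol S Z Z'" and "0 \<le> s" "s \<le> t" "t \<le> S"
  shows "Z s \<le> Z t"
proof (rule DERIV_nonneg_imp_increasing_open[where f = Z])
  fix x assume "s < x" "x < t"
  then show "\<exists>y. (Z has_real_derivative y) (at x) \<and> 0 \<le> y"
    using assms sol_deriv_nonneg[OF Z, of x]
    by (intro exI[of _ "Z' x"]) (auto simp: sol_def)
next
  show "continuous_on {s..t} Z"
    using assms by (auto simp: sol_def intro: continuous_on_subset)
qed (use assms in auto)

lemma pos_sol_pos:
  assumes Z: "pos_sol S Z Z'" and "0 < s" "s \<le> S"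
  shows "0 < Z s"
  using sol_mono[OF pos_sol_imp_sol[OF Z], of "s / 2" s] assms
  by (auto simp: pos_sol_def sol_def intro: less_le_trans[of 0 "Z (s / 2)"])

text \<open>Both sides solve the equation, but the right-hand one starts from positive data, and
  the nonlinearity is concave: at the best constant \<open>K\<close> with \<open>Z1 \<le> K Z2(\<cdot> + \<epsilon>)\<close>
  the difference is nondecreasing, so it cannot touch zero if \<open>K > 1\<close>.\<close>

lemma pos_sol_le_shift:
  assumes Z1: "pos_sol S Z1 Z1'" and Z2: "pos_sol S Z2 Z2'"
    and \<epsilon>: "0 < \<epsilon>" "0 \<le> s" "s + \<epsilon> \<le> S"
  shows "Z1 s \<le> Z2 (s + \<epsilon>)"
proof -
  let ?b = "S - \<epsilon>"
  have Z2_pos: "0 < Z2 (t + \<epsilon>)" if "t \<in> {0..?b}" for t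
    using that \<epsilon> by (intro pos_sol_pos[OF Z2]) auto
  have shift: "continuous_on {0..?b} (\<lambda>t. f (t + \<epsilon>))" if "continuous_on {0..S} f" for f :: "real \<Rightarrow> real"
    using that \<epsilon> by (intro continuous_on_compose2[OF that] continuous_intros) auto
  have cont: "continuous_on {0..?b} Z1" "continuous_on {0..?b} Z1'"
    "continuous_on {0..?b} (\<lambda>t. Z2 (t + \<epsilon>))" "continuous_on {0..?b} (\<lambda>t. Z2' (t + \<epsilon>))"
    using Z1 Z2 \<epsilon> by (auto simp: pos_sol_def sol_def intro: shift continuous_on_subset)
  have "continuous_on {0..?b} (\<lambda>t. Z1 t / Z2 (t + \<epsilon>))"
    using Z2_pos by (intro continuous_intros cont) force
  then obtain s0 where s0: "s0 \<in> {0..?b}"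
    and max: "\<And>t. t \<in> {0..?b} \<Longrightarrow> Z1 t / Z2 (t + \<epsilon>) \<le> Z1 s0 / Z2 (s0 + \<epsilon>)"
    using continuous_attains_sup[of "{0..?b}" "\<lambda>t. Z1 t / Z2 (t + \<epsilon>)"] \<epsilon> by auto
  define K where "K = Z1 s0 / Z2 (s0 + \<epsilon>)"
  have le: "Z1 t \<le> K * Z2 (t + \<epsilon>)" if "t \<in> {0..?b}" for t
    using max[OF that] Z2_pos[OF that] unfolding K_def[symmetric] by (simp add: divide_le_eq)
  have "K \<le> 1"
  proof (rule ccontr)
    assume K: "\<not> K \<le> 1"
    define D where "D = (\<lambda>t. K * Z2 (t + \<epsilon>) - Z1 t)"
    define D' where "D' = (\<lambda>t. K * Z2' (t + \<epsilon>) - Z1' t)"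
    have D'_nonneg: "0 \<le> D' t" if t: "t \<in> {0..?b}" for t
    proof (rule damped_nonneg[where f = D' and a = 0])
      show "0 \<le> t" using t by simp
      have "continuous_on {0..?b} D'"
        unfolding D'_def by (intro continuous_intros cont)
      then show "continuous_on {0..t} D'"
        by (rule continuous_on_subset) (use t in auto)
      show "0 \<le> D' 0"
        using Z1 K sol_deriv_nonneg[OF pos_sol_imp_sol[OF Z2], of \<epsilon>] \<epsilon> by (simp add: D'_def pos_sol_def sol_def)
      fix r assume r: "0 < r" "r < t"
      have "((\<lambda>t. Z2' (t + \<epsilon>)) has_real_derivative (Z2 (r + \<epsilon>) powr \<alpha> - Z2' (r + \<epsilon>))) (at r)"
        using Z2 r t \<epsilon> by (intro iffD1[OF DERIV_shift]) (auto simp: pos_sol_def sol_def)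
      then show "(D' has_real_derivative (K * (Z2 (r + \<epsilon>) powr \<alpha> - Z2' (r + \<epsilon>))
          - (Z1 r powr \<alpha> - Z1' r))) (at r)"
        unfolding D'_def using Z1 r t \<epsilon>
        by (intro DERIV_diff DERIV_cmult) (auto simp: pos_sol_def sol_def)
      have "Z1 r powr \<alpha> \<le> (K * Z2 (r + \<epsilon>)) powr \<alpha>"
        using le[of r] r t \<epsilon> \<alpha>_pos pos_sol_pos[OF Z1, of r] by (intro powr_mono2) auto
      also have "\<dots> = K powr \<alpha> * Z2 (r + \<epsilon>) powr \<alpha>"
        using K Z2_pos[of r] r t by (intro powr_mult)
      \<comment> \<open>Sublinearity enters here: \<open>K powr \<alpha> \<le> K\<close> because
        \<open>K > 1\<close> and \<open>\<alpha> < 1\<close>.\<close>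
      also have "\<dots> \<le> K * Z2 (r + \<epsilon>) powr \<alpha>"
        using K \<alpha>_less powr_mono[of \<alpha> 1 K] by (intro mult_right_mono) auto
      finally show "0 \<le> K * (Z2 (r + \<epsilon>) powr \<alpha> - Z2' (r + \<epsilon>)) - (Z1 r powr \<alpha> - Z1' r) + D' r"
        by (simp add: D'_def algebra_simps)
    qed
    have "D 0 \<le> D s0"
    proof (rule DERIV_nonneg_imp_increasing_open[where f = D])
      show "0 \<le> s0" using s0 by simp
      have "continuous_on {0..?b} D"
        unfolding D_def by (intro continuous_intros cont)
      then show "continuous_on {0..s0} D"
        by (rule continuous_on_subset) (use s0 in auto)
      fix r assume r: "0 < r" "r < s0"
      have "((\<lambda>t. Z2 (t + \<epsilon>)) has_real_derivative Z2' (r + \<epsilon>)) (at r)"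
        using Z2 r s0 \<epsilon> by (intro iffD1[OF DERIV_shift]) (auto simp: pos_sol_def sol_def)
      then have "(D has_real_derivative D' r) (at r)"
        unfolding D_def D'_def using Z1 r s0 \<epsilon>
        by (intro DERIV_diff DERIV_cmult) (auto simp: pos_sol_def sol_def)
      then show "\<exists>y. (D has_real_derivative y) (at r) \<and> 0 \<le> y"
        using D'_nonneg[of r] r s0 by auto
    qed
    moreover have "D s0 = 0" using Z2_pos[OF s0] by (simp add: D_def K_def)
    moreover have "D 0 > 0" using Z1 K Z2_pos[of 0] \<epsilon> by (simp add: D_def pos_sol_def sol_def)
    ultimately show False by simp
  qed
  have "Z1 s \<le> K * Z2 (s + \<epsilon>)" using le \<epsilon> by simp
  also have "\<dots> \<le> Z2 (s + \<epsilon>)"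
    using \<open>K \<le> 1\<close> Z2_pos[of s] \<epsilon> mult_right_mono[of K 1 "Z2 (s + \<epsilon>)"] by simp
  finally show ?thesis .
qed

text \<open>Let the shift \<epsilon> tend to 0 from the right. The point stays below
  \<open>S\<close> so that there is room for the shift.\<close>

lemma pos_sol_le:
  assumes Z1: "pos_sol S Z1 Z1'" and Z2: "pos_sol S Z2 Z2'" and s: "0 < s" "s < S"
  shows "Z1 s \<le> Z2 s"
proof (rule tendsto_lowerbound)
  have "isCont Z2 s"
    using Z2 s by (auto simp: pos_sol_def sol_def intro: DERIV_isCont)
  then show "((\<lambda>\<epsilon>. Z2 (s + \<epsilon>)) \<longlongrightarrow> Z2 s) (at_right 0)"
    by (simp add: isCont_iff filterlim_at_split)
  have "eventually (\<lambda>\<epsilon>. \<epsilon> \<in> {0<..<S - s}) (at_right 0)"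
    using s by (intro eventually_at_right_real) simp
  then show "\<forall>\<^sub>F \<epsilon> in at_right 0. Z1 s \<le> Z2 (s + \<epsilon>)"
    by eventually_elim (use s in \<open>auto intro!: pos_sol_le_shift[OF Z1 Z2]\<close>)
qed auto

text \<open>Comparison in both directions gives equality in the interior, hence equality of the
  derivatives there; continuity carries both to the endpoints.\<close>

lemma pos_sol_unique:
  assumes Z1: "pos_sol S Z1 Z1'" and Z2: "pos_sol S Z2 Z2'" and s: "s \<in> {0..S}" "0 < S"
  shows "Z1 s = Z2 s" "Z1' s = Z2' s"
proof -
  have closure: "closure {0<..<S} = {0..S}" using s by simp
  have eq: "Z1 t = Z2 t" if "t \<in> {0<..<S}" for t
    using pos_sol_le[OF Z1 Z2] pos_sol_le[OF Z2 Z1] that by (simp add: order_antisym)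
  have eq': "Z1' t = Z2' t" if t: "t \<in> {0<..<S}" for t
  proof -
    have "(Z1 has_real_derivative Z2' t) (at t)"
      by (rule has_field_derivative_transform_within_open[where S = "{0<..<S}" and f = Z2])
        (use Z2 t eq in \<open>auto simp: pos_sol_def sol_def\<close>)
    moreover have "(Z1 has_real_derivative Z1' t) (at t)"
      using Z1 t by (auto simp: pos_sol_def sol_def)
    ultimately show ?thesis using DERIV_unique by blast
  qed
  have "Z1 s - Z2 s = 0"
    by (rule continuous_constant_on_closure[where S = "{0<..<S}"], unfold closure)
      (use Z1 Z2 s eq in \<open>auto simp: pos_sol_def sol_def intro!: continuous_intros\<close>)
  then show "Z1 s = Z2 s" by simp
  have "Z1' s - Z2' s = 0"
    by (rule continuous_constant_on_closure[where S = "{0<..<S}"], unfold closure)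
      (use Z1 Z2 s eq' in \<open>auto simp: pos_sol_def sol_def intro!: continuous_intros\<close>)
  then show "Z1' s = Z2' s" by simp
qed

section \<open>Monotonicity and range of the logarithmic derivative\<close>

lemma U_powr_pos: "0 < s \<Longrightarrow> 0 < U s powr b"
  using U_pos[of s] by simp

lemma V_pos:
  assumes "0 < s" shows "0 < V s"
  using assms U_powr_pos DERIV_V V_continuous V_0
  by (intro damped_pos[of 0 s V "\<lambda>s. U s powr \<alpha> - V s"]) auto

lemma DERIV_U_powr:
  assumes "0 < s"
  shows "((\<lambda>s. U s powr b) has_real_derivative b * U s powr (b - 1) * V s) (at s)"
  using DERIV_powr[OF DERIV_U[OF assms] U_pos[OF assms] DERIV_const[of b]] U_pos[OF assms]
  by (simp add: powr_diff field_simps)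

text \<open>The difference is \<open>U''\<close>, and its sum with its own derivative is
  \<open>(U powr \<alpha>)' > 0\<close>. This convexity of \<open>U\<close> becomes
  \<open>v'' > 0\<close>.\<close>

lemma V_less:
  assumes "0 < s" shows "V s < U s powr \<alpha>"
proof -
  have "0 < U s powr \<alpha> - V s"
  proof (rule damped_pos[OF assms])
    show "continuous_on {0..s} (\<lambda>s. U s powr \<alpha> - V s)"
      by (intro continuous_intros U_powr_continuous V_continuous)
    show "0 \<le> U 0 powr \<alpha> - V 0" by (simp add: U_0 V_0)
    fix t :: real assume t: "0 < t"
    show "((\<lambda>s. U s powr \<alpha> - V s) has_real_derivative
        \<alpha> * U t powr (\<alpha> - 1) * V t - (U t powr \<alpha> - V t)) (at t)"
      using t by (intro DERIV_diff DERIV_U_powr DERIV_V)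
    show "0 < \<alpha> * U t powr (\<alpha> - 1) * V t - (U t powr \<alpha> - V t) + (U t powr \<alpha> - V t)"
      using mult_pos_pos[OF mult_pos_pos[OF \<alpha>_pos U_powr_pos] V_pos] t by simp
  qed
  then show ?thesis by simp
qed

lemma V_mono:
  assumes "0 < s" "s \<le> t" shows "V s \<le> V t"
  using assms(2)
proof (rule DERIV_nonneg_imp_nondecreasing)
  fix x assume "s \<le> x"
  then show "\<exists>y. (V has_real_derivative y) (at x) \<and> 0 \<le> y"
    using assms(1) V_less[of x] DERIV_V[of x] by (intro exI[of _ "U x powr \<alpha> - V x"]) auto
qed

text \<open>This is \<open>- U\<^sup>2 (V / U)'\<close>; together with its derivative it sums to \<open>(1 - \<alpha>) U\<^sup>\<alpha> V > 0\<close>.\<close>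

lemma quotient_numerator_pos:
  assumes "0 < s" shows "0 < U s * V s + V s * V s - U s * U s powr \<alpha>"
proof (rule damped_pos[OF assms])
  show "continuous_on {0..s} (\<lambda>s. U s * V s + V s * V s - U s * U s powr \<alpha>)"
    by (intro continuous_intros U_powr_continuous V_continuous U_continuous)
  show "0 \<le> U 0 * V 0 + V 0 * V 0 - U 0 * U 0 powr \<alpha>" by (simp add: U_0 V_0)
  fix t :: real assume t: "0 < t"
  let ?d = "U t powr \<alpha> - V t"
  show "((\<lambda>s. U s * V s + V s * V s - U s * U s powr \<alpha>) has_real_derivative
      (V t * V t + ?d * U t) + (?d * V t + ?d * V t)
        - (V t * U t powr \<alpha> + \<alpha> * U t powr (\<alpha> - 1) * V t * U t)) (at t)"
    using t by (intro DERIV_diff DERIV_add DERIV_mult DERIV_U_powr DERIV_V DERIV_U)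
  have "U t powr (\<alpha> - 1) * U t = U t powr \<alpha>"
    using U_pos[OF t] by (simp add: powr_diff)
  then have "(V t * V t + ?d * U t) + (?d * V t + ?d * V t)
      - (V t * U t powr \<alpha> + \<alpha> * U t powr (\<alpha> - 1) * V t * U t)
      + (U t * V t + V t * V t - U t * U t powr \<alpha>) = (1 - \<alpha>) * U t powr \<alpha> * V t"
    by (simp add: algebra_simps)
  also have "\<dots> > 0" using mult_pos_pos[OF mult_pos_pos[of "1 - \<alpha>", OF _ U_powr_pos] V_pos] t \<alpha>_less by simp
  finally show "0 < (V t * V t + ?d * U t) + (?d * V t + ?d * V t)
      - (V t * U t powr \<alpha> + \<alpha> * U t powr (\<alpha> - 1) * V t * U t)
      + (U t * V t + V t * V t - U t * U t powr \<alpha>)" .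
qed

lemma DERIV_quotient:
  assumes "0 < s"
  shows "((\<lambda>s. V s / U s) has_real_derivative
    - (U s * V s + V s * V s - U s * U s powr \<alpha>) / (U s * U s)) (at s)"
  using assms U_pos[OF assms]
  by (auto intro!: derivative_eq_intros DERIV_V DERIV_U simp: field_simps)

lemma quotient_strict_decreasing:
  assumes "0 < s" "s < t" shows "V t / U t < V s / U s"
  using assms(2)
proof (rule DERIV_neg_imp_decreasing[where f = "\<lambda>s. V s / U s"])
  fix x assume "s \<le> x"
  then have "0 < x" using assms by simp
  then show "\<exists>y. ((\<lambda>s. V s / U s) has_real_derivative y) (at x) \<and> y < 0"
    using quotient_numerator_pos[of x] U_pos[of x] DERIV_quotient[of x]
    by (intro exI[of _ "- (U x * V x + V x * V x - U x * U x powr \<alpha>) / (U x * U x)"] conjI)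
      (auto intro!: divide_neg_pos)
qed

text \<open>By the mean value theorem \<open>U s = s * V z\<close> with \<open>z < s\<close>, and
  \<open>V\<close> is nondecreasing. It shows that the quotient blows up at 0.\<close>

lemma quotient_ge:
  assumes "0 < s" shows "1 / s \<le> V s / U s"
proof -
  have "\<exists>l z. 0 < z \<and> z < s \<and> (U has_real_derivative l) (at z) \<and> U s - U 0 = (s - 0) * l"
    using assms U_continuous DERIV_U
    by (intro MVT) (auto simp: real_differentiable_def)
  then obtain z where z: "0 < z" "z < s" "U s - U 0 = (s - 0) * V z"
    using DERIV_U DERIV_unique by blast
  then have "U s \<le> s * V s"
    using V_mono[of z s] assms U_0 by (simp add: mult_left_mono)
  then show ?thesis using U_pos[OF assms] assms by (simp add: field_simps)
qed

text \<open>A convex function lies above its tangent, here the one at 1, with the positive value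
  \<open>U 1\<close> dropped.\<close>

lemma U_unbounded:
  assumes "1 \<le> s" shows "V 1 * (s - 1) \<le> U s"
proof -
  have "U 1 - V 1 * 1 \<le> U s - V 1 * s"
    using assms
  proof (rule DERIV_nonneg_imp_nondecreasing)
    fix x :: real assume x: "1 \<le> x"
    then have "((\<lambda>s. U s - V 1 * s) has_real_derivative V x - V 1) (at x)"
      by (auto intro!: derivative_eq_intros DERIV_U)
    then show "\<exists>y. ((\<lambda>s. U s - V 1 * s) has_real_derivative y) (at x) \<and> 0 \<le> y"
      using V_mono[of 1 x] x by (intro exI conjI) auto
  qed
  then show ?thesis using U_pos[of 1] by (simp add: algebra_simps)
qed

text \<open>Intermediate value theorem: the quotient is at least \<open>1 / s\<close>, and at most
  \<open>U s powr (\<alpha> - 1)\<close>, which becomes small because \<open>U\<close> is unbounded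
  and the exponent is negative.\<close>

lemma quotient_surj:
  assumes "0 < k" obtains \<tau> where "0 < \<tau>" "V \<tau> / U \<tau> = k"
proof -
  \<comment> \<open>\<open>B\<close> solves \<open>B powr (\<alpha> - 1) = k\<close>, and
    \<open>b\<close> is the point at which the tangent bound reaches \<open>B\<close>.\<close>
  define B where "B = k powr (1 / (\<alpha> - 1))"
  define b where "b = 1 + B / V 1"
  have B: "0 < B" using assms by (simp add: B_def)
  have b: "1 \<le> b" using B V_pos[of 1] by (simp add: b_def)
  have "B \<le> U b"
    using U_unbounded[OF b] V_pos[of 1] by (simp add: b_def)
  have "V b / U b \<le> U b powr \<alpha> / U b"
    using V_less[of b] U_pos[of b] b by (intro divide_right_mono) auto
  also have "\<dots> = U b powr (\<alpha> - 1)"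
    using U_pos[of b] b by (simp add: powr_diff)
  also have "\<dots> \<le> B powr (\<alpha> - 1)"
    using \<open>B \<le> U b\<close> B \<alpha>_less by (intro powr_mono2') auto
  also have "\<dots> = k"
    using assms \<alpha>_less by (simp add: B_def powr_powr)
  finally have upper: "V b / U b \<le> k" .
  \<comment> \<open>The bound \<open>1 / k\<close> makes the quotient at least \<open>k\<close> at
    \<open>a\<close>; the minimum keeps \<open>a\<close> to the left of \<open>b\<close>.\<close>
  define a where "a = min b (1 / k)"
  have a: "0 < a" "a \<le> b" using assms b by (auto simp: a_def)
  have "a \<le> 1 / k" by (simp add: a_def)
  then have "k \<le> 1 / a" using a assms by (simp add: field_simps)
  then have lower: "k \<le> V a / U a" using quotient_ge[OF a(1)] by simp
  have "continuous_on {a..b} (\<lambda>s. V s / U s)"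
    using a less_imp_neq[OF U_pos]
    by (intro continuous_on_divide continuous_on_subset[OF V_continuous[of b]]
        continuous_on_subset[OF U_continuous[of b]]) force+
  then obtain \<tau> where "a \<le> \<tau>" "V \<tau> / U \<tau> = k"
    using IVT2'[OF upper lower a(2)] by auto
  then show thesis using a by (intro that[of \<tau>]) auto
qed

text \<open>Divided by \<open>s powr p\<close>, both barriers tend to \<open>A\<close>.\<close>

lemma U_asymp: "((\<lambda>s. U s / s powr p) \<longlongrightarrow> A) (at_right 0)"
proof (rule tendsto_sandwich)
  show "((\<lambda>s. exp (- s * p / 2) * A) \<longlongrightarrow> A) (at_right 0)"
    by (auto intro!: tendsto_eq_intros)
  show "((\<lambda>s. A) \<longlongrightarrow> A) (at_right 0)" by simp
  have pos: "eventually (\<lambda>s::real. 0 < s) (at_right 0)" by (simp add: eventually_at_filter)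
  show "\<forall>\<^sub>F s in at_right 0. exp (- s * p / 2) * A \<le> U s / s powr p"
    using pos by eventually_elim
      (use sub_le_U in \<open>simp add: sub_def super_def field_simps\<close>)
  show "\<forall>\<^sub>F s in at_right 0. U s / s powr p \<le> A"
    using pos by eventually_elim
      (use U_le_super in \<open>simp add: super_def field_simps\<close>)
qed

end

section \<open>Asymptotics at the free boundary\<close>

lemma eventually_pos_at_right_0: "eventually (\<lambda>s::real. 0 < s) (at_right 0)"
  by (simp add: eventually_at_filter)

text \<open>\<open>asymp_power n a f\<close>: the expansion \<open>f \<sim> l s\<^sup>a\<close> as \<open>s \<rightarrow> 0+\<close> may be differentiated
  \<open>n\<close> times. The limit \<open>l\<close> may be zero, so that the class is closed under sums and the
  exponent may be lowered.\<close>

primrec asymp_power :: "nat \<Rightarrow> real \<Rightarrow> (real \<Rightarrow> real) \<Rightarrow> bool" where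
  "asymp_power 0 a f \<longleftrightarrow> (\<exists>l. ((\<lambda>s. f s / s powr a) \<longlongrightarrow> l) (at_right 0))"
| "asymp_power (Suc n) a f \<longleftrightarrow> (\<exists>l. ((\<lambda>s. f s / s powr a) \<longlongrightarrow> l) (at_right 0)) \<and>
     (\<forall>s>0. f differentiable (at s)) \<and> asymp_power n (a - 1) (deriv f)"

section \<open>Calculus of differentiable power asymptotics\<close>

lemma asymp_power_limit:
  "asymp_power n a f \<Longrightarrow> \<exists>l. ((\<lambda>s. f s / s powr a) \<longlongrightarrow> l) (at_right 0)"
  by (cases n) auto

lemma asymp_power_DERIV:
  "asymp_power (Suc n) a f \<Longrightarrow> 0 < s \<Longrightarrow> (f has_real_derivative deriv f s) (at s)"
  using DERIV_deriv_iff_real_differentiable by auto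

text \<open>The right-hand limits and the derivatives at positive points see only the open
  half-line, where the functions agree.\<close>

lemma asymp_power_cong:
  assumes "asymp_power n a f" "\<And>s. 0 < s \<Longrightarrow> f s = g s"
  shows "asymp_power n a g"
  using assms
proof (induction n arbitrary: a f g)
  case 0
  have "((\<lambda>s. f s / s powr a) \<longlongrightarrow> l) (at_right 0) \<longleftrightarrow>
      ((\<lambda>s. g s / s powr a) \<longlongrightarrow> l) (at_right 0)" for l
    using eventually_pos_at_right_0 by (intro tendsto_cong, elim eventually_mono) (use 0 in auto)
  with 0 show ?case by simp
next
  case (Suc n)
  have eq: "((\<lambda>s. f s / s powr a) \<longlongrightarrow> l) (at_right 0) \<longleftrightarrow>
      ((\<lambda>s. g s / s powr a) \<longlongrightarrow> l) (at_right 0)" for l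
    using eventually_pos_at_right_0 by (intro tendsto_cong, elim eventually_mono) (use Suc in auto)
  have D: "(g has_real_derivative deriv f s) (at s)" if "0 < s" for s
    by (rule has_field_derivative_transform_within_open[where S = "{0<..}" and f = f])
      (use that Suc.prems asymp_power_DERIV[OF Suc.prems(1)] in auto)
  then have "deriv f s = deriv g s" if "0 < s" for s
    using DERIV_imp_deriv that by metis
  then have "asymp_power n (a - 1) (deriv g)"
    using Suc.IH[of "a - 1" "deriv f"] Suc.prems by auto
  then show ?case using Suc.prems eq D real_differentiable_def by auto
qed

text \<open>Lets a known derivative on the positive half-line stand in for
  \<open>deriv f\<close>.\<close>

lemma asymp_power_SucI:
  assumes "((\<lambda>s. f s / s powr a) \<longlongrightarrow> l) (at_right 0)"
    and "\<And>s. 0 < s \<Longrightarrow> (f has_real_derivative f' s) (at s)" "asymp_power n (a - 1) f'"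
  shows "asymp_power (Suc n) a f"
proof -
  have "asymp_power n (a - 1) (deriv f)"
    by (rule asymp_power_cong[OF assms(3)]) (use DERIV_imp_deriv[OF assms(2)] in simp)
  then show ?thesis using assms real_differentiable_def by auto
qed

lemma asymp_power_Suc_imp: "asymp_power (Suc n) a f \<Longrightarrow> asymp_power n a f"
  by (induction n arbitrary: a f) auto

lemma asymp_power_add:
  "asymp_power n a f \<Longrightarrow> asymp_power n a g \<Longrightarrow> asymp_power n a (\<lambda>s. f s + g s)"
proof (induction n arbitrary: a f g)
  case 0
  then show ?case by (auto simp: add_divide_distrib intro: tendsto_add)
next
  case (Suc n)
  obtain l m where "((\<lambda>s. f s / s powr a) \<longlongrightarrow> l) (at_right 0)"
    "((\<lambda>s. g s / s powr a) \<longlongrightarrow> m) (at_right 0)"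
    using Suc.prems by auto
  then have "((\<lambda>s. (f s + g s) / s powr a) \<longlongrightarrow> l + m) (at_right 0)"
    by (auto simp: add_divide_distrib intro: tendsto_add)
  then show ?case
  proof (rule asymp_power_SucI)
    show "((\<lambda>s. f s + g s) has_real_derivative deriv f s + deriv g s) (at s)" if "0 < s" for s
      using that by (intro DERIV_add asymp_power_DERIV[OF Suc.prems(1)] asymp_power_DERIV[OF Suc.prems(2)])
    show "asymp_power n (a - 1) (\<lambda>s. deriv f s + deriv g s)"
      using Suc.prems by (intro Suc.IH) auto
  qed
qed

text \<open>The quotient gains a factor \<open>s\<close>, so its limit becomes 0. Used to bring
  terms of different order to a common exponent.\<close>

lemma asymp_power_lower: "asymp_power n a f \<Longrightarrow> asymp_power n (a - 1) f"
proof -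
  have limit: "\<exists>l. ((\<lambda>s. f s / s powr (a - 1)) \<longlongrightarrow> l) (at_right 0)"
    if "((\<lambda>s. f s / s powr a) \<longlongrightarrow> l) (at_right 0)" for f :: "real \<Rightarrow> real" and a l
  proof -
    have 1: "((\<lambda>s. f s / s powr a * s) \<longlongrightarrow> l * 0) (at_right 0)"
      by (intro tendsto_mult that tendsto_ident_at)
    have 2: "\<forall>\<^sub>F s in at_right 0. f s / s powr a * s = f s / s powr (a - 1)"
      using eventually_pos_at_right_0 by eventually_elim (simp add: powr_diff)
    show ?thesis using Lim_transform_eventually[OF 1 2] by blast
  qed
  show "asymp_power n a f \<Longrightarrow> asymp_power n (a - 1) f"
  proof (induction n arbitrary: a f)
    case 0
    then show ?case using limit by auto
  next
    case (Suc n)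
    then have "\<exists>l. ((\<lambda>s. f s / s powr (a - 1)) \<longlongrightarrow> l) (at_right 0)"
      using limit[of f a] by auto
    with Suc.IH[of "a - 1" "deriv f"] Suc.prems show ?case by simp
  qed
qed

text \<open>By the product rule, since the orders \<open>(a - 1) + b\<close> and
  \<open>(b - 1) + a\<close> of the two terms agree.\<close>

lemma asymp_power_mult:
  "asymp_power n a f \<Longrightarrow> asymp_power n b g \<Longrightarrow> asymp_power n (a + b) (\<lambda>s. f s * g s)"
proof (induction n arbitrary: a b f g)
  case 0
  then obtain l m where "((\<lambda>s. f s / s powr a) \<longlongrightarrow> l) (at_right 0)"
    "((\<lambda>s. g s / s powr b) \<longlongrightarrow> m) (at_right 0)" by auto
  then have "((\<lambda>s. f s / s powr a * (g s / s powr b)) \<longlongrightarrow> l * m) (at_right 0)"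
    by (rule tendsto_mult)
  then show ?case by (auto simp: powr_add)
next
  case (Suc n)
  then obtain l m where "((\<lambda>s. f s / s powr a) \<longlongrightarrow> l) (at_right 0)"
    "((\<lambda>s. g s / s powr b) \<longlongrightarrow> m) (at_right 0)" by auto
  then have "((\<lambda>s. f s / s powr a * (g s / s powr b)) \<longlongrightarrow> l * m) (at_right 0)"
    by (rule tendsto_mult)
  then have "((\<lambda>s. f s * g s / s powr (a + b)) \<longlongrightarrow> l * m) (at_right 0)"
    by (simp add: powr_add)
  then show ?case
  proof (rule asymp_power_SucI)
    show "((\<lambda>s. f s * g s) has_real_derivative deriv f s * g s + deriv g s * f s) (at s)" if "0 < s" for s
      using that by (intro DERIV_mult asymp_power_DERIV[OF Suc.prems(1)] asymp_power_DERIV[OF Suc.prems(2)])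
    have "asymp_power n (a - 1 + b) (\<lambda>s. deriv f s * g s)"
      using Suc.prems asymp_power_Suc_imp by (intro Suc.IH) auto
    moreover have "asymp_power n (b - 1 + a) (\<lambda>s. deriv g s * f s)"
      using Suc.prems asymp_power_Suc_imp by (intro Suc.IH) auto
    ultimately show "asymp_power n (a + b - 1) (\<lambda>s. deriv f s * g s + deriv g s * f s)"
      by (intro asymp_power_add) (simp_all add: algebra_simps)
  qed
qed

lemma asymp_power_const: "asymp_power n 0 (\<lambda>s. c)"
proof -
  have zero: "asymp_power n a (\<lambda>s. 0)" for n a
    by (induction n arbitrary: a) auto
  have "((\<lambda>s::real. c / s powr 0) \<longlongrightarrow> c) (at_right 0)"
    using eventually_pos_at_right_0 by (intro tendsto_eventually, elim eventually_mono) auto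
  then show ?thesis using zero by (cases n) (auto intro: exI[of _ c])
qed

lemma asymp_power_cmult:
  "asymp_power n a f \<Longrightarrow> asymp_power n a (\<lambda>s. c * f s)"
  using asymp_power_mult[OF asymp_power_const] by simp

lemma asymp_power_derivs:
  assumes "asymp_power n a f" "k \<le> n"
  shows "\<exists>l. ((\<lambda>s. (deriv ^^ k) f s / s powr (a - real k)) \<longlongrightarrow> l) (at_right 0)"
    and "k < n \<Longrightarrow> 0 < s \<Longrightarrow>
      ((deriv ^^ k) f has_real_derivative (deriv ^^ Suc k) f s) (at s)"
proof -
  have "asymp_power (n - k) (a - real k) ((deriv ^^ k) f)"
    using assms(2)
  proof (induction k)
    case (Suc k)
    then have "asymp_power (Suc (n - Suc k)) (a - real k) ((deriv ^^ k) f)"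
      by (simp add: Suc_diff_Suc)
    then show ?case by (simp add: algebra_simps)
  qed (use assms in simp)
  note * = this
  show "\<exists>l. ((\<lambda>s. (deriv ^^ k) f s / s powr (a - real k)) \<longlongrightarrow> l) (at_right 0)"
    using asymp_power_limit[OF *] .
  assume "k < n" "0 < s"
  then have "asymp_power (Suc (n - Suc k)) (a - real k) ((deriv ^^ k) f)"
    using * by (simp add: Suc_diff_Suc)
  from asymp_power_DERIV[OF this \<open>0 < s\<close>]
  show "((deriv ^^ k) f has_real_derivative (deriv ^^ Suc k) f s) (at s)" by simp
qed

text \<open>L'Hospital's rule for the difference quotient at 0: a right limit of the derivative is
  the one-sided derivative.\<close>

lemma DERIV_endpoint:
  fixes f f' :: "real \<Rightarrow> real"
  assumes f: "(f \<longlongrightarrow> f 0) (at_right 0)" and f': "(f' \<longlongrightarrow> l) (at_right 0)"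
    and D: "\<And>s. 0 < s \<Longrightarrow> (f has_real_derivative f' s) (at s)"
  shows "(f has_real_derivative l) (at 0 within {0..})"
proof -
  have "((\<lambda>s. (f s - f 0) / s) \<longlongrightarrow> l) (at_right 0)"
  proof (rule lhopital_right_0)
    show "((\<lambda>s. f s - f 0) \<longlongrightarrow> 0) (at_right 0)"
      using tendsto_diff[OF f tendsto_const[of "f 0"]] by simp
    show "\<forall>\<^sub>F s in at_right 0. ((\<lambda>s. f s - f 0) has_real_derivative f' s) (at s)"
      using eventually_pos_at_right_0 by eventually_elim (auto intro!: derivative_eq_intros D)
    show "\<forall>\<^sub>F s::real in at_right 0. ((\<lambda>s. s) has_real_derivative 1) (at s)"
      by (auto intro!: always_eventually derivative_eq_intros)
    show "\<forall>\<^sub>F s::real in at_right 0. s \<noteq> 0"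
      using eventually_pos_at_right_0 by eventually_elim simp
  qed (use f' in \<open>auto intro: tendsto_ident_at\<close>)
  then show ?thesis by (simp add: has_field_derivative_iff at_within_Ici_at_right)
qed

text \<open>Subadditivity of a concave power: dividing by \<open>s\<close>, it follows from
  \<open>x \<le> x powr g\<close> on the unit interval, applied to the two parts of 1.\<close>

lemma powr_diff_le:
  fixes s t g :: real
  assumes "0 \<le> t" "t \<le> s" "0 < g" "g \<le> 1"
  shows "s powr g - t powr g \<le> (s - t) powr g"
proof (cases "s = 0")
  case False
  then have s: "0 < s" using assms by simp
  have le: "x \<le> x powr g" if "0 \<le> x" "x \<le> 1" for x :: real
    using that assms powr_mono'[of g 1 x] by (cases "x = 0") auto
  have "1 = t / s + (s - t) / s" using s by (simp add: field_simps)
  also have "\<dots> \<le> (t / s) powr g + ((s - t) / s) powr g"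
    using s assms by (intro add_mono le) auto
  also have "\<dots> = (t powr g + (s - t) powr g) / s powr g"
    using s assms by (simp add: powr_divide add_divide_distrib)
  finally show ?thesis using s by (simp add: field_simps)
qed (use assms in simp)

section \<open>Derivatives of the profile near zero\<close>

context sublinear
begin

text \<open>L'Hospital's rule is applied to \<open>exp s * V s\<close>, whose derivative
  \<open>exp s * U s powr \<alpha>\<close> does not involve \<open>V\<close> and has known
  asymptotics.\<close>

lemma V_asymp: "((\<lambda>s. V s / s powr (p - 1)) \<longlongrightarrow> A * p) (at_right 0)"
proof -
  note pos = eventually_pos_at_right_0
  have "((\<lambda>s. (U s powr \<alpha> * exp s) / ((p - 1) * s powr (p - 2))) \<longlongrightarrow>
      A powr \<alpha> / (p - 1) * exp 0) (at_right 0)"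
  proof (rule Lim_transform_eventually)
    show "((\<lambda>s. (U s / s powr p) powr \<alpha> / (p - 1) * exp s) \<longlongrightarrow> A powr \<alpha> / (p - 1) * exp 0) (at_right 0)"
      using p_gt_2 A_pos by (intro tendsto_intros U_asymp) auto
    show "\<forall>\<^sub>F s in at_right 0. (U s / s powr p) powr \<alpha> / (p - 1) * exp s =
        U s powr \<alpha> * exp s / ((p - 1) * s powr (p - 2))"
      using pos by eventually_elim
        (use U_nonneg p_gt_2 in \<open>simp add: powr_divide powr_powr p_mult_\<alpha> field_simps\<close>)
  qed
  then have "((\<lambda>s. (exp s * V s) / s powr (p - 1)) \<longlongrightarrow> A powr \<alpha> / (p - 1) * exp 0) (at_right 0)"
  proof (rule lhopital_right_0[rotated -1])
    have V: "(V \<longlongrightarrow> 0) (at_right 0)"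
    proof -
      have "(V \<longlongrightarrow> V 0) (at 0 within {0..1})"
        using V_continuous[of 1] by (auto simp: continuous_on)
      then show ?thesis by (simp add: V_0 at_within_Icc_at_right)
    qed
    have "((\<lambda>s. exp s * V s) \<longlongrightarrow> exp 0 * 0) (at_right 0)"
      by (intro tendsto_mult V tendsto_intros)
    then show "((\<lambda>s. exp s * V s) \<longlongrightarrow> 0) (at_right 0)" by simp
    have "((\<lambda>s::real. s powr (p - 1)) \<longlongrightarrow> 0 powr (p - 1)) (at_right 0)"
      using p_gt_2 pos by (intro tendsto_powr') (auto elim: eventually_mono)
    then show "((\<lambda>s::real. s powr (p - 1)) \<longlongrightarrow> 0) (at_right 0)" by simp
    show "\<forall>\<^sub>F s::real in at_right 0. s powr (p - 1) \<noteq> 0"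
      using pos by eventually_elim simp
    show "\<forall>\<^sub>F s::real in at_right 0. (p - 1) * s powr (p - 2) \<noteq> 0"
      using pos by eventually_elim (use p_gt_2 in simp)
    show "\<forall>\<^sub>F s in at_right 0. ((\<lambda>s. exp s * V s) has_real_derivative U s powr \<alpha> * exp s) (at s)"
      using pos by eventually_elim (auto intro!: derivative_eq_intros DERIV_V simp: algebra_simps)
    show "\<forall>\<^sub>F s in at_right 0. ((\<lambda>s. s powr (p - 1)) has_real_derivative (p - 1) * s powr (p - 2)) (at s)"
      using pos by eventually_elim (auto intro!: derivative_eq_intros)
  qed
  then have "((\<lambda>s. exp (- s) * ((exp s * V s) / s powr (p - 1))) \<longlongrightarrow>
      exp (- 0) * (A powr \<alpha> / (p - 1) * exp 0)) (at_right 0)"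
    by (intro tendsto_mult tendsto_intros)
  moreover have "exp (- s) * ((exp s * V s) / s powr (p - 1)) = V s / s powr (p - 1)" for s
    by (simp add: exp_minus)
  ultimately have "((\<lambda>s. V s / s powr (p - 1)) \<longlongrightarrow> exp (- 0) * (A powr \<alpha> / (p - 1) * exp 0)) (at_right 0)"
    by (simp only:)
  then show ?thesis using p_gt_2 by (simp add: A_powr)
qed

text \<open>All exponents \<open>b\<close> are treated at once because differentiation passes to
  \<open>b - 1\<close>. The orders fit: \<open>p * (b - 1) + (p - 1) = p * b - 1\<close>.\<close>

lemma asymp_power_U_powr:
  assumes "asymp_power n p U" "asymp_power n (p - 1) V"
  shows "asymp_power n (p * b) (\<lambda>s. U s powr b)"
  using assms
proof (induction n arbitrary: b)
  have limit: "((\<lambda>s. U s powr b / s powr (p * b)) \<longlongrightarrow> A powr b) (at_right 0)" for b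
  proof (rule Lim_transform_eventually)
    show "((\<lambda>s. (U s / s powr p) powr b) \<longlongrightarrow> A powr b) (at_right 0)"
      using A_pos by (intro tendsto_intros U_asymp) auto
    show "\<forall>\<^sub>F s in at_right 0. (U s / s powr p) powr b = U s powr b / s powr (p * b)"
      using eventually_pos_at_right_0 by eventually_elim (use U_nonneg in \<open>simp add: powr_divide powr_powr\<close>)
  qed
  {
    case 0
    show ?case using limit by auto
  next
    case (Suc n)
    have "asymp_power n (p * (b - 1)) (\<lambda>s. U s powr (b - 1))" "asymp_power n (p - 1) V"
      using Suc.prems by (auto intro!: Suc.IH dest: asymp_power_Suc_imp simp del: asymp_power.simps)
    from asymp_power_cmult[OF asymp_power_mult[OF this], of b]
    have "asymp_power n (p * b - 1) (\<lambda>s. b * U s powr (b - 1) * V s)"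
      by (simp add: algebra_simps)
    with limit DERIV_U_powr show ?case by (rule asymp_power_SucI)
  }
qed

text \<open>Bootstrapping: \<open>U' = V\<close> and \<open>V' = U powr \<alpha> - V\<close> each
  turn the expansions of order \<open>n\<close> into one more derivative. Both terms of
  \<open>V'\<close> are brought to the exponent \<open>p - 2\<close>.\<close>

lemma asymp_power_U_V: "asymp_power n p U \<and> asymp_power n (p - 1) V"
proof (induction n)
  case 0
  show ?case using U_asymp V_asymp by auto
next
  case (Suc n)
  have U: "asymp_power (Suc n) p U"
    using U_asymp DERIV_U Suc.IH by (intro asymp_power_SucI) auto
  have "asymp_power n (p - 2) (\<lambda>s. U s powr \<alpha>)"
    using asymp_power_U_powr[of n \<alpha>] Suc.IH by (simp add: p_mult_\<alpha>)
  moreover have "asymp_power n (p - 1 - 1) (\<lambda>s. - 1 * V s)"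
    using Suc.IH by (intro asymp_power_cmult asymp_power_lower[of n "p - 1"]) simp
  ultimately have "asymp_power n (p - 1 - 1) (\<lambda>s. U s powr \<alpha> + - 1 * V s)"
    by (intro asymp_power_add) (simp_all add: algebra_simps)
  then have "asymp_power (Suc n) (p - 1) V"
    using V_asymp DERIV_V by (intro asymp_power_SucI) auto
  with U show ?case by simp
qed

text \<open>The value at 0 is meaningful only for \<open>k \<le> p\<close>; beyond that the limit need not exist.\<close>

definition dU :: "nat \<Rightarrow> real \<Rightarrow> real" where
  "dU k s = (if 0 < s then (deriv ^^ k) U s else Lim (at_right 0) ((deriv ^^ k) U))"

lemma deriv_U_asymp: "\<exists>l. ((\<lambda>s. (deriv ^^ k) U s / s powr (p - real k)) \<longlongrightarrow> l) (at_right 0)"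
  using asymp_power_derivs(1)[of k p U k] asymp_power_U_V by blast

lemma DERIV_dU:
  assumes "0 < s" shows "(dU k has_real_derivative dU (Suc k) s) (at s)"
proof (rule has_field_derivative_transform_within_open[where S = "{0<..}"])
  show "((deriv ^^ k) U has_real_derivative dU (Suc k) s) (at s)"
    using asymp_power_derivs(2)[of "Suc k" p U k s] asymp_power_U_V assms by (auto simp: dU_def)
qed (use assms in \<open>auto simp: dU_def\<close>)

lemma dU_tendsto_0:
  assumes "real k \<le> p" shows "(dU k \<longlongrightarrow> dU k 0) (at_right 0)"
proof -
  obtain l where "((\<lambda>s. (deriv ^^ k) U s / s powr (p - real k)) \<longlongrightarrow> l) (at_right 0)"
    using deriv_U_asymp by blast
  moreover have "\<exists>m. ((\<lambda>s. s powr (p - real k)) \<longlongrightarrow> m) (at_right 0)"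
  \<comment> \<open>The case is separate because \<open>0 powr 0 = 0\<close>, whereas the limit is
    1.\<close>
  proof (cases "p = real k")
    case True
    have "((\<lambda>s. s powr (p - real k)) \<longlongrightarrow> 1) (at_right 0)"
      using eventually_pos_at_right_0
      by (intro tendsto_eventually, elim eventually_mono) (use True in auto)
    then show ?thesis ..
  next
    case False
    then have "((\<lambda>s. s powr (p - real k)) \<longlongrightarrow> 0 powr (p - real k)) (at_right 0)"
      using assms eventually_pos_at_right_0
      by (intro tendsto_powr') (auto elim: eventually_mono)
    then show ?thesis ..
  qed
  then obtain m where "((\<lambda>s. s powr (p - real k)) \<longlongrightarrow> m) (at_right 0)" ..
  ultimately have 1: "((\<lambda>s. (deriv ^^ k) U s / s powr (p - real k) * s powr (p - real k)) \<longlongrightarrow> l * m) (at_right 0)"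
    by (rule tendsto_mult)
  have 2: "\<forall>\<^sub>F s in at_right 0.
      (deriv ^^ k) U s / s powr (p - real k) * s powr (p - real k) = (deriv ^^ k) U s"
    using eventually_pos_at_right_0 by eventually_elim simp
  have lim: "((deriv ^^ k) U \<longlongrightarrow> l * m) (at_right 0)"
    by (rule Lim_transform_eventually[OF 1 2])
  then have "dU k 0 = l * m" by (simp add: dU_def tendsto_Lim)
  moreover have "\<forall>\<^sub>F s in at_right 0. (deriv ^^ k) U s = dU k s"
    using eventually_pos_at_right_0 by eventually_elim (simp add: dU_def)
  ultimately show ?thesis using Lim_transform_eventually[OF lim] by simp
qed

lemma DERIV_dU_within:
  assumes "real (Suc k) \<le> p" "0 \<le> s"
  shows "(dU k has_real_derivative dU (Suc k) s) (at s within {0..})"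
proof (cases "s = 0")
  case True
  then show ?thesis
    using assms DERIV_endpoint[OF dU_tendsto_0[of k] dU_tendsto_0[of "Suc k"] DERIV_dU] by simp
next
  case False
  then show ?thesis using assms by (auto intro: has_field_derivative_at_within[OF DERIV_dU])
qed

lemma dU_continuous:
  assumes "real k \<le> p" shows "continuous_on {0..} (dU k)"
  unfolding continuous_on_def
proof
  fix s :: real assume s: "s \<in> {0..}"
  show "(dU k \<longlongrightarrow> dU k s) (at s within {0..})"
  proof (cases "s = 0")
    case True
    then show ?thesis using dU_tendsto_0[OF assms] by (simp add: at_within_Ici_at_right)
  next
    case False
    then have "isCont (dU k) s" using DERIV_isCont[OF DERIV_dU] s by auto
    from continuous_at_imp_continuous_at_within[OF this]
    show ?thesis by (simp add: continuous_within)
  qed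
qed

lemma dU_0: "0 \<le> s \<Longrightarrow> dU 0 s = U s"
proof (cases "s = 0")
  case True
  have "(U \<longlongrightarrow> U 0) (at 0 within {0..1})"
    using U_continuous[of 1] by (auto simp: continuous_on)
  then show ?thesis using True by (simp add: dU_def U_0 at_within_Icc_at_right tendsto_Lim)
qed (simp add: dU_def)

text \<open>The next derivative is bounded by a multiple of \<open>s powr (g - 1)\<close>.
  Integrating gives a bound by a difference of powers \<open>g\<close>, to which subadditivity
  applies.\<close>

lemma dU_Holder:
  assumes g: "0 < p - real n" "p - real n \<le> 1" and "0 < \<tau>"
  shows "\<exists>C\<ge>0. \<forall>s\<in>{0..\<tau>}. \<forall>t\<in>{0..\<tau>}. \<bar>dU n s - dU n t\<bar> \<le> C * \<bar>s - t\<bar> powr (p - real n)"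
proof -
  define g where "g = p - real n"
  have g_pos: "0 < g" "g \<le> 1" using g by (auto simp: g_def)
  obtain l where l: "((\<lambda>s. (deriv ^^ Suc n) U s / s powr (g - 1)) \<longlongrightarrow> l) (at_right 0)"
    using deriv_U_asymp[of "Suc n"] by (auto simp: g_def algebra_simps)
  \<comment> \<open>The rescaled derivative, given its limit as value at 0, is continuous on a
    compact interval and hence bounded.\<close>
  define h where "h s = (if s = 0 then l else dU (Suc n) s / s powr (g - 1))" for s
  have "continuous_on {0..\<tau>} h"
    unfolding continuous_on_def
  proof
    fix s assume s: "s \<in> {0..\<tau>}"
    show "(h \<longlongrightarrow> h s) (at s within {0..\<tau>})"
    proof (cases "s = 0")
      case True
      have "\<forall>\<^sub>F s in at_right 0. (deriv ^^ Suc n) U s / s powr (g - 1) = h s"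
        using eventually_pos_at_right_0 by eventually_elim (simp add: h_def dU_def)
      with l have "(h \<longlongrightarrow> l) (at_right 0)" by (rule Lim_transform_eventually)
      then show ?thesis using True \<open>0 < \<tau>\<close> by (simp add: at_within_Icc_at_right h_def)
    next
      case False
      then have "isCont (\<lambda>s. dU (Suc n) s / s powr (g - 1)) s"
        using s DERIV_isCont[OF DERIV_dU] by (intro continuous_intros) auto
      from continuous_at_imp_continuous_at_within[OF this] have 1: "((\<lambda>s. dU (Suc n) s / s powr (g - 1)) \<longlongrightarrow> h s) (at s within {0..\<tau>})"
        using False by (simp add: h_def continuous_within)
      have 2: "\<forall>\<^sub>F t in at s within {0..\<tau>}. dU (Suc n) t / t powr (g - 1) = h t"
        unfolding h_def
        using False eventually_at_in_open'[of "{0<..}" s] s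
        by (intro eventually_at_filter[THEN iffD2]) (auto simp: eventually_nhds intro!: exI[of _ "{0<..}"])
      show ?thesis by (rule Lim_transform_eventually[OF 1 2])
    qed
  qed
  then have "bounded (h ` {0..\<tau>})"
    by (intro compact_imp_bounded compact_continuous_image) auto
  then obtain C where C: "0 < C" "\<And>s. s \<in> {0..\<tau>} \<Longrightarrow> \<bar>h s\<bar> \<le> C"
    by (auto simp: bounded_pos)
  have bound: "\<bar>dU (Suc n) s\<bar> \<le> C * s powr (g - 1)" if "0 < s" "s \<le> \<tau>" for s
    using C(2)[of s] that by (simp add: h_def field_simps)
  have "real n \<le> p" using g by simp
  note cont = continuous_on_subset[OF dU_continuous[OF this]]
  have le: "\<bar>dU n s - dU n t\<bar> \<le> C / g * \<bar>s - t\<bar> powr g" if st: "0 \<le> t" "t \<le> s" "s \<le> \<tau>" for s t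
  proof -
    \<comment> \<open>The signs \<open>e = 1\<close> and \<open>e = - 1\<close> give the two halves
      of the absolute value; the added power has a derivative dominating that of
      \<open>dU n\<close>.\<close>
    have "C / g * t powr g + e * dU n t \<le> C / g * s powr g + e * dU n s" if e: "\<bar>e\<bar> = 1" for e
    proof (rule DERIV_nonneg_imp_increasing_open[where f = "\<lambda>s. C / g * s powr g + e * dU n s", OF st(2)])
      show "continuous_on {t..s} (\<lambda>s. C / g * s powr g + e * dU n s)"
        using st g_pos by (intro continuous_intros continuous_on_powr' cont) auto
      fix r assume r: "t < r" "r < s"
      have "((\<lambda>s. C / g * s powr g + e * dU n s) has_real_derivative
          C / g * (g * r powr (g - 1)) + e * dU (Suc n) r) (at r)"
        using r st by (intro DERIV_add DERIV_cmult DERIV_dU has_real_derivative_powr) auto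
      moreover have "C / g * (g * r powr (g - 1)) = C * r powr (g - 1)"
        using g_pos by simp
      moreover have "\<bar>e * dU (Suc n) r\<bar> \<le> C * r powr (g - 1)"
        using bound[of r] r st e by (simp add: abs_mult)
      ultimately show "\<exists>y. ((\<lambda>s. C / g * s powr g + e * dU n s) has_real_derivative y) (at r) \<and> 0 \<le> y"
        by (intro exI[of _ "C / g * (g * r powr (g - 1)) + e * dU (Suc n) r"]) auto
    qed
    from this[of 1] this[of "- 1"]
    have "\<bar>dU n s - dU n t\<bar> \<le> C / g * (s powr g - t powr g)"
      by (simp add: right_diff_distrib)
    also have "\<dots> \<le> C / g * (s - t) powr g"
      using C g_pos st by (intro mult_left_mono powr_diff_le) auto
    finally show ?thesis using st by simp
  qed
  have "\<bar>dU n s - dU n t\<bar> \<le> C / g * \<bar>s - t\<bar> powr g" if "s \<in> {0..\<tau>}" "t \<in> {0..\<tau>}" for s t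
    using le[of t s] le[of s t] that by (cases "t \<le> s") (auto simp: abs_minus_commute)
  then show ?thesis using C g_pos unfolding g_def by (intro exI[of _ "C / (p - real n)"]) auto
qed

end

section \<open>Iterated derivatives and flatness\<close>

text \<open>A derivative within a set is unique only at non-isolated points; a connected set with
  more than one point has no isolated ones.\<close>

lemma Icc_within_neq_bot: "a < b \<Longrightarrow> x \<in> {a..b} \<Longrightarrow> at x within {a..b} \<noteq> bot" for a b x :: real
  using connected_imp_perfect[of "{a..b}" x] by (auto simp: trivial_limit_within) 

lemma Ico_within_neq_bot: "x \<in> {a..<b} \<Longrightarrow> at x within {a..<b} \<noteq> bot" for a b x :: real
proof -
  assume x: "x \<in> {a..<b}"
  have "{a..<b} \<noteq> {y}" for y
  proof
    assume "{a..<b} = {y}"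
    moreover have "(x + b) / 2 \<in> {a..<b}" using x by auto
    ultimately have "x \<in> {y}" "(x + b) / 2 \<in> {y}" using x by metis+
    then show False using x by auto
  qed
  then show ?thesis using connected_imp_perfect[of "{a..<b}" x] x by (auto simp: trivial_limit_within)
qed

lemma deriv_on_eq:
  assumes "(f has_real_derivative D) (at x within S)" "at x within S \<noteq> bot"
  shows "deriv_on S f x = D"
  using assms unfolding deriv_on_def
  by (intro vector_derivative_within) (auto simp: has_real_derivative_iff_has_vector_derivative)

text \<open>Identifies the iterated derivatives with an explicit sequence \<open>F\<close>, so that
  they need not be computed from \<open>deriv_on\<close>.\<close>

lemma deriv_on_funpow:
  assumes nonbot: "\<And>x. x \<in> S \<Longrightarrow> at x within S \<noteq> bot"
    and D: "\<And>k x. k < n \<Longrightarrow> x \<in> S \<Longrightarrow> (F k has_real_derivative F (Suc k) x) (at x within S)"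
    and "k \<le> n" "x \<in> S"
  shows "(deriv_on S ^^ k) (F 0) x = F k x"
  using assms(3,4)
proof (induction k arbitrary: x)
  case (Suc k)
  have "((deriv_on S ^^ k) (F 0) has_real_derivative F (Suc k) x) (at x within S)"
    using Suc by (intro has_field_derivative_transform_within[OF D zero_less_one]) auto
  then show ?case using Suc.prems by (simp add: deriv_on_eq nonbot)
qed simp

lemma Ck_onI:
  assumes nonbot: "\<And>x. x \<in> S \<Longrightarrow> at x within S \<noteq> bot"
    and D: "\<And>k x. k < n \<Longrightarrow> x \<in> S \<Longrightarrow> (F k has_real_derivative F (Suc k) x) (at x within S)"
    and cont: "continuous_on S (F n)"
  shows "Ck_on n S (F 0)"
  unfolding Ck_on_def
proof (intro conjI allI impI ballI)
  note eq = deriv_on_funpow[of S n F, OF nonbot D]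
  show "continuous_on S ((deriv_on S ^^ n) (F 0))"
    using cont by (rule continuous_on_eq) (simp add: eq)
  fix j x assume j: "j < n" and x: "x \<in> S"
  have "((deriv_on S ^^ j) (F 0) has_real_derivative F (Suc j) x) (at x within S)"
    by (rule has_field_derivative_transform_within[OF D[OF j x] zero_less_one x]) (use j in \<open>simp add: eq\<close>)
  then show "(deriv_on S ^^ j) (F 0) differentiable at x within S"
    by (auto simp: real_differentiable_def)
qed

lemma Ck_on_DERIV:
  assumes "Ck_on n S f" "k < n" "x \<in> S"
  shows "((deriv_on S ^^ k) f has_real_derivative (deriv_on S ^^ Suc k) f x) (at x within S)"
  using assms by (simp add: Ck_on_def deriv_on_def has_real_derivative_iff_has_vector_derivative
      flip: vector_derivative_works)

lemma Ck_on_continuous: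
  assumes "Ck_on n S f" "k \<le> n"
  shows "continuous_on S ((deriv_on S ^^ k) f)"
proof (cases "k = n")
  case False
  then have "\<And>x. x \<in> S \<Longrightarrow>
      ((deriv_on S ^^ k) f has_real_derivative (deriv_on S ^^ Suc k) f x) (at x within S)"
    using assms by (intro Ck_on_DERIV) auto
  then show ?thesis by (rule DERIV_continuous_on)
qed (use assms in \<open>simp add: Ck_on_def\<close>)

text \<open>Excludes extending a solution by zero beyond its free boundary.\<close>

lemma Cinf_on_flat:
  assumes f: "Cinf_on {a..<b} f" and x1: "a < x1" "x1 < b"
    and zero: "\<And>x. x \<in> {x1..<b} \<Longrightarrow> f x = 0" and "0 < n"
  shows "\<exists>C. \<forall>x\<in>{(a + x1) / 2..<x1}. \<bar>f x\<bar> \<le> C * (x1 - x) ^ n"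
proof -
  define d where "d m = (deriv_on {a..<b} ^^ m) f" for m
  have D: "(d m has_real_derivative d (Suc m) x) (at x within {a..<b})" if "x \<in> {a..<b}" for m x
    unfolding d_def using f that
    by (intro Ck_on_DERIV[of "Suc m"]) (auto simp: Cinf_on_def)
  have D': "(d m has_real_derivative d (Suc m) x) (at x)" if "a < x" "x < b" for m x
  proof -
    have "(d m has_real_derivative d (Suc m) x) (at x within {a<..<b})"
      by (rule DERIV_subset[OF D]) (use that in auto)
    moreover have "at x within {a<..<b} = at x" using that by (intro at_within_open) auto
    ultimately show ?thesis by simp
  qed
  \<comment> \<open>The point \<open>x1\<close> is included: there the derivative within
    \<open>{x1..<b}\<close>, taken of the zero function, must agree with the derivative within the
    larger interval.\<close>
  have d_zero: "d m x = 0" if "x \<in> {x1..<b}" for m x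
    using that
  proof (induction m arbitrary: x)
    case 0
    then show ?case using zero by (simp add: d_def)
  next
    case (Suc m)
    note bot = Ico_within_neq_bot[OF Suc.prems]
    have "(d m has_real_derivative d (Suc m) x) (at x within {x1..<b})"
      by (rule DERIV_subset[OF D]) (use Suc.prems x1 in auto)
    then have "deriv_on {x1..<b} (d m) x = d (Suc m) x" by (rule deriv_on_eq[OF _ bot])
    moreover have "(d m has_real_derivative 0) (at x within {x1..<b})"
      by (rule has_field_derivative_transform_within[OF DERIV_const zero_less_one Suc.prems])
        (simp add: Suc.IH)
    then have "deriv_on {x1..<b} (d m) x = 0" by (rule deriv_on_eq[OF _ bot])
    ultimately show ?case by simp
  qed
  have "continuous_on {(a + x1) / 2..x1} (d n)"
    using x1 by (intro DERIV_continuous_on[OF has_field_derivative_at_within[OF D']]) auto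
  then have "bounded (d n ` {(a + x1) / 2..x1})"
    by (intro compact_imp_bounded compact_continuous_image) auto
  then obtain C where C: "\<bar>y\<bar> \<le> C" if "y \<in> d n ` {(a + x1) / 2..x1}" for y
    unfolding bounded_real by blast
  show ?thesis
  proof (intro exI ballI)
    fix x assume x: "x \<in> {(a + x1) / 2..<x1}"
    \<comment> \<open>Taylor expansion about \<open>x1\<close>: all terms below order
      \<open>n\<close> vanish and only the remainder is left.\<close>
    have "\<exists>t. x < t \<and> t < x1 \<and> f x = (\<Sum>m<n. (d m x1 / fact m) * (x - x1) ^ m)
        + (d n t / fact n) * (x - x1) ^ n"
      using x x1 \<open>0 < n\<close> by (intro Taylor_down[of n d f x x1 x1]) (auto intro!: D' simp: d_def[of 0])
    then obtain t where t: "x < t" "t < x1" and "f x = (d n t / fact n) * (x - x1) ^ n"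
      using d_zero x1 by auto
    then have "\<bar>f x\<bar> = \<bar>d n t\<bar> / fact n * (x1 - x) ^ n"
      using x by (simp add: abs_mult power_abs abs_minus_commute)
    also have "\<dots> \<le> C / fact n * (x1 - x) ^ n"
      using C[of "d n t"] t x by (intro mult_right_mono divide_right_mono) auto
    finally show "\<bar>f x\<bar> \<le> C / fact n * (x1 - x) ^ n" .
  qed
qed

section \<open>Zero sets of nonnegative solutions and the first derivatives of the profile\<close>

context sublinear
begin

text \<open>Take \<open>s1\<close> as the last zero. Monotonicity forces \<open>Z\<close> to vanish
  before it, and \<open>Z'\<close> vanishes there by the initial condition or at an interior
  minimum. The solution restarted at \<open>s1\<close> is therefore positive and coincides with
  \<open>U\<close>.\<close>

lemma sol_eq_shifted_U:
  assumes Z: "sol S Z Z'" and S: "0 < S" and nonneg: "\<And>s. s \<in> {0..S} \<Longrightarrow> 0 \<le> Z s" and "0 < Z S"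
  obtains s1 where "0 \<le> s1" "s1 < S" "\<And>s. s \<in> {0..s1} \<Longrightarrow> Z s = 0"
    "\<And>s. s \<in> {0..S - s1} \<Longrightarrow> Z (s + s1) = U s \<and> Z' (s + s1) = V s"
proof -
  let ?N = "{0..S} \<inter> Z -` {0}"
  have "closed ?N"
    using Z by (intro continuous_closed_preimage) (auto simp: sol_def)
  then have "compact ?N"
    by (simp add: compact_eq_bounded_closed bounded_Int)
  moreover have "0 \<in> ?N" using Z S by (simp add: sol_def)
  ultimately obtain s1 where s1: "s1 \<in> ?N" and max: "\<And>s. s \<in> ?N \<Longrightarrow> s \<le> s1"
    using compact_attains_sup[of ?N] by blast
  have s1_less: "0 \<le> s1" "s1 < S"
    using s1 \<open>0 < Z S\<close> by (auto simp: less_le)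
  have zero: "Z s = 0" if "s \<in> {0..s1}" for s
    using sol_mono[OF Z, of s s1] nonneg[of s] s1 s1_less that by auto
  have Z'_s1: "Z' s1 = 0"
  proof (cases "s1 = 0")
    case False
    show ?thesis
    proof (rule DERIV_local_min)
      show "(Z has_real_derivative Z' s1) (at s1)"
        using Z s1_less False by (auto simp: sol_def)
      show "0 < min s1 (S - s1)" using s1_less False by simp
      show "\<forall>y. \<bar>s1 - y\<bar> < min s1 (S - s1) \<longrightarrow> Z s1 \<le> Z y"
        using nonneg s1 by (auto simp: abs_if split: if_splits)
    qed
  qed (use Z in \<open>simp add: sol_def\<close>)
  have "pos_sol (S - s1) (\<lambda>s. Z (s + s1)) (\<lambda>s. Z' (s + s1))"
    unfolding pos_sol_def sol_def
  proof (intro conjI ballI)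
    have cont: "continuous_on {0..S - s1} (\<lambda>s. f (s + s1))" if "continuous_on {0..S} f" for f :: "real \<Rightarrow> real"
      using s1_less by (intro continuous_on_compose2[OF that] continuous_intros) auto
    show "continuous_on {0..S - s1} (\<lambda>s. Z (s + s1))" "continuous_on {0..S - s1} (\<lambda>s. Z' (s + s1))"
      using Z by (auto simp: sol_def intro: cont)
    fix s assume s: "s \<in> {0<..<S - s1}"
    show "((\<lambda>s. Z (s + s1)) has_real_derivative Z' (s + s1)) (at s)"
      using Z s s1_less by (intro iffD1[OF DERIV_shift]) (auto simp: sol_def)
    show "((\<lambda>s. Z' (s + s1)) has_real_derivative Z (s + s1) powr \<alpha> - Z' (s + s1)) (at s)"
      using Z s s1_less by (intro iffD1[OF DERIV_shift]) (auto simp: sol_def)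
    show "0 < Z (s + s1)"
      using max[of "s + s1"] nonneg[of "s + s1"] s s1_less by force
  qed (use s1 Z'_s1 in auto)
  from pos_sol_unique[OF this pos_sol_U] s1_less
  have "Z (s + s1) = U s \<and> Z' (s + s1) = V s" if "s \<in> {0..S - s1}" for s
    using that by auto
  with s1_less zero show thesis using that by blast
qed

text \<open>Dividing by \<open>s powr p\<close>, the bound would make the limit \<open>A\<close> at
  most 0.\<close>

lemma U_not_flat:
  assumes "p < real n" "0 < e" shows "\<not> (\<forall>s\<in>{0<..<e}. U s \<le> C * s ^ n)"
proof
  assume le: "\<forall>s\<in>{0<..<e}. U s \<le> C * s ^ n"
  have "A \<le> C * 0"
  proof (rule tendsto_le)
    show "((\<lambda>s. U s / s powr p) \<longlongrightarrow> A) (at_right 0)" by (rule U_asymp)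
    have "((\<lambda>s. s powr (real n - p)) \<longlongrightarrow> 0 powr (real n - p)) (at_right 0)"
      using assms eventually_pos_at_right_0 by (intro tendsto_powr') (auto elim: eventually_mono)
    then show "((\<lambda>s. C * s powr (real n - p)) \<longlongrightarrow> C * 0) (at_right 0)"
      by (intro tendsto_mult tendsto_const) simp
    have "\<forall>\<^sub>F s in at_right 0. s \<in> {0<..<e}"
      using assms by (intro eventually_at_right_real) simp
    then show "\<forall>\<^sub>F s in at_right 0. U s / s powr p \<le> C * s powr (real n - p)"
      by eventually_elim (use le in \<open>simp add: powr_diff powr_realpow divide_right_mono\<close>)
  qed simp
  then show False using A_pos by simp
qed

lemma dU_1: "0 \<le> s \<Longrightarrow> dU 1 s = V s"
proof -
  have pos: "dU 1 s = V s" if "0 < s" for s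
    using DERIV_imp_deriv[OF DERIV_U[OF that]] that by (simp add: dU_def)
  have "(V \<longlongrightarrow> V 0) (at 0 within {0..1})"
    using V_continuous[of 1] by (auto simp: continuous_on)
  then have "(V \<longlongrightarrow> V 0) (at_right 0)" by (simp add: at_within_Icc_at_right)
  moreover have "\<forall>\<^sub>F s in at_right 0. V s = dU 1 s"
    using eventually_pos_at_right_0 by eventually_elim (rule pos[symmetric])
  ultimately have "(dU 1 \<longlongrightarrow> V 0) (at_right 0)" by (rule Lim_transform_eventually)
  then have "dU 1 0 = V 0"
    using tendsto_unique[OF trivial_limit_at_right_real dU_tendsto_0[of 1]] p_gt_2 by simp
  with pos show "dU 1 s = V s" if "0 \<le> s" using that by (cases "s = 0") auto
qed

lemma dU_2:
  assumes "0 < s" shows "dU 2 s = U s powr \<alpha> - V s"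
proof -
  have "(dU 1 has_real_derivative U s powr \<alpha> - V s) (at s)"
    by (rule has_field_derivative_transform_within_open[OF DERIV_V, of s "{0<..}"])
      (use assms dU_1 in auto)
  moreover have "(dU 1 has_real_derivative dU 2 s) (at s)"
    using DERIV_dU[OF assms, of 1] by (simp add: numeral_2_eq_2)
  ultimately show ?thesis using DERIV_unique by blast
qed

end

section \<open>The free boundary problem\<close>

context sublinear
begin

text \<open>\<open>v\<close> is written with \<open>dU 0\<close> in place of \<open>U\<close> so
  that its derivatives up to the free boundary are given by \<open>dU\<close>. The relation between
  \<open>lam\<close> and \<open>c\<close> is the one that makes the scaling respect the
  equation.\<close>

lemma fb_solution_scaled_U:
  assumes "0 < \<Lambda>" "0 < c" "0 < lam" "0 < \<tau>"
    and lam: "lam * c\<^sup>2 = \<Lambda> * lam powr \<alpha>"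
    and v0: "lam * U \<tau> = v0" "lam * V \<tau> = 1 - v0"
  defines "\<mu> \<equiv> c / \<Lambda>"
  defines "R \<equiv> \<tau> / \<mu>"
  defines "v \<equiv> \<lambda>\<xi>. lam * dU 0 (\<tau> - \<mu> * \<xi>)"
  shows "fb_solution \<alpha> \<Lambda> v0 c R v"
    and "\<forall>\<xi>\<in>{0..<R}. 0 < v \<xi> \<and> deriv_on {0..R} v \<xi> < 0 \<and>
           0 < deriv_on {0..R} (deriv_on {0..R} v) \<xi>"
proof -
  define F where "F k \<xi> = lam * (- \<mu>) ^ k * dU k (\<tau> - \<mu> * \<xi>)" for k \<xi>
  have v: "v = F 0" by (simp add: F_def[abs_def] v_def)
  have \<mu>: "0 < \<mu>" using assms by (simp add: \<mu>_def)
  have R: "0 < R" using \<mu> assms by (simp add: R_def)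
  have arg_nonneg: "0 \<le> \<tau> - \<mu> * \<xi>" if "\<xi> \<in> {0..R}" for \<xi>
    using that \<mu> by (simp add: R_def field_simps)
  have arg_le: "\<tau> - \<mu> * \<xi> \<le> \<tau>" if "\<xi> \<in> {0..R}" for \<xi>
    using that \<mu> by simp
  have arg_pos: "0 < \<tau> - \<mu> * \<xi>" if "\<xi> \<in> {0..<R}" for \<xi>
    using that \<mu> by (simp add: R_def field_simps)
  have nonbot: "at x within {0..R} \<noteq> bot" if "x \<in> {0..R}" for x
    using Icc_within_neq_bot[OF R that] .
  have lin: "((\<lambda>\<xi>. \<tau> - \<mu> * \<xi>) has_real_derivative - \<mu>) (at \<xi> within S)" for \<xi> S
    by (auto intro!: derivative_eq_intros)
  \<comment> \<open>At \<open>R\<close> the argument of \<open>dU\<close> reaches 0, which is why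
    the order is limited by \<open>p\<close>.\<close>
  have DF: "(F k has_real_derivative F (Suc k) \<xi>) (at \<xi> within {0..R})"
    if "real (Suc k) \<le> p" "\<xi> \<in> {0..R}" for k \<xi>
  proof -
    have "(dU k has_real_derivative dU (Suc k) (\<tau> - \<mu> * \<xi>))
        (at (\<tau> - \<mu> * \<xi>) within (\<lambda>\<xi>. \<tau> - \<mu> * \<xi>) ` {0..R})"
      by (rule DERIV_subset[OF DERIV_dU_within]) (use that arg_nonneg in auto)
    from DERIV_cmult[OF DERIV_image_chain[OF this lin], of "lam * (- \<mu>) ^ k"]
    show ?thesis by (simp add: F_def[abs_def] o_def algebra_simps)
  qed
  \<comment> \<open>Before \<open>R\<close> the argument stays positive and every order is allowed;
    this gives smoothness on \<open>{0..<R}\<close>.\<close>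
  have DF': "(F k has_real_derivative F (Suc k) \<xi>) (at \<xi> within {0..<R})" if "\<xi> \<in> {0..<R}" for k \<xi>
  proof -
    have "((\<lambda>\<xi>. lam * (- \<mu>) ^ k * dU k (\<tau> - \<mu> * \<xi>)) has_real_derivative
        lam * (- \<mu>) ^ k * (dU (Suc k) (\<tau> - \<mu> * \<xi>) * - \<mu>)) (at \<xi> within {0..<R})"
      by (intro DERIV_cmult DERIV_chain2[OF DERIV_dU lin] arg_pos that)
    then show ?thesis by (simp add: F_def[abs_def] algebra_simps)
  qed
  have Ck: "Ck_on n {0..R} (F 0)" if "real n \<le> p" for n
  proof (rule Ck_onI[where F = F])
    have "continuous_on {0..R} (\<lambda>\<xi>. dU n (\<tau> - \<mu> * \<xi>))"
      using arg_nonneg by (intro continuous_on_compose2[OF dU_continuous[OF that]] continuous_intros) auto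
    then show "continuous_on {0..R} (F n)"
      unfolding F_def by (intro continuous_intros)
  qed (use that nonbot DF in auto)
  have deriv: "(deriv_on {0..R} ^^ k) v \<xi> = F k \<xi>" if "real k \<le> p" "\<xi> \<in> {0..R}" for k \<xi>
    unfolding v using that by (intro deriv_on_funpow[of "{0..R}" k F] nonbot DF) auto
  have v': "deriv_on {0..R} v \<xi> = - (lam * \<mu> * V (\<tau> - \<mu> * \<xi>))" if "\<xi> \<in> {0..R}" for \<xi>
    using deriv[of 1 \<xi>] p_gt_2 that dU_1[OF arg_nonneg[OF that]] by (simp add: F_def)
  have v'': "deriv_on {0..R} (deriv_on {0..R} v) \<xi> =
      lam * \<mu>\<^sup>2 * (U (\<tau> - \<mu> * \<xi>) powr \<alpha> - V (\<tau> - \<mu> * \<xi>))" if "\<xi> \<in> {0..<R}" for \<xi>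
    using deriv[of 2 \<xi>] p_gt_2 that dU_2[OF arg_pos[OF that]]
    by (simp add: F_def numeral_2_eq_2)
  have v_eq: "v \<xi> = lam * U (\<tau> - \<mu> * \<xi>)" if "\<xi> \<in> {0..R}" for \<xi>
    using dU_0[OF arg_nonneg[OF that]] by (simp add: v_def)
  show "\<forall>\<xi>\<in>{0..<R}. 0 < v \<xi> \<and> deriv_on {0..R} v \<xi> < 0 \<and>
           0 < deriv_on {0..R} (deriv_on {0..R} v) \<xi>"
  proof
    fix \<xi> assume \<xi>: "\<xi> \<in> {0..<R}"
    then show "0 < v \<xi> \<and> deriv_on {0..R} v \<xi> < 0 \<and> 0 < deriv_on {0..R} (deriv_on {0..R} v) \<xi>"
      using U_pos[OF arg_pos[OF \<xi>]] V_pos[OF arg_pos[OF \<xi>]] V_less[OF arg_pos[OF \<xi>]] \<mu> \<open>0 < lam\<close>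
      by (simp add: v_eq v' v'')
  qed
  have "fb_problem \<alpha> \<Lambda> v0 c R v"
    unfolding fb_problem_def Let_def
  proof (intro conjI ballI)
    fix \<xi> assume \<xi>: "\<xi> \<in> {0<..<R}"
    let ?s = "\<tau> - \<mu> * \<xi>"
    \<comment> \<open>Since \<open>\<Lambda> * \<mu> = c\<close>, the terms with \<open>V\<close>
      cancel.\<close>
    have "\<Lambda> * (lam * \<mu>\<^sup>2 * (U ?s powr \<alpha> - V ?s)) - c * - (lam * \<mu> * V ?s) =
        lam * c\<^sup>2 / \<Lambda> * U ?s powr \<alpha>"
      using \<open>0 < \<Lambda>\<close> by (simp add: \<mu>_def power2_eq_square field_simps)
    also have "\<dots> = (lam * U ?s) powr \<alpha>"
      using lam \<open>0 < \<Lambda>\<close> \<open>0 < lam\<close> by (simp add: powr_mult)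
    finally show "\<Lambda> * deriv_on {0..R} (deriv_on {0..R} v) \<xi> - c * deriv_on {0..R} v \<xi> = v \<xi> powr \<alpha>"
      using \<xi> by (simp add: v_eq v' v'')
  next
    show "deriv_on {0..R} v 0 = - (c / \<Lambda>) * (1 - v0)"
      using R v0 by (simp add: v' \<mu>_def mult_ac flip: v0(2))
  next
    have "\<mu> * R = \<tau>" using \<mu> by (simp add: R_def)
    then show "v R = 0" "deriv_on {0..R} v R = 0" "v 0 = v0"
      using R v0 by (simp_all add: v_eq v' U_0 V_0)
    show "0 \<le> v \<xi>" if "\<xi> \<in> {0..R}" for \<xi>
      using U_nonneg[OF arg_nonneg[OF that]] \<open>0 < lam\<close> that by (simp add: v_eq)
  qed
  moreover have "Cinf_on {0..<R} v"
    unfolding Cinf_on_def v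
    by (intro allI Ck_onI Ico_within_neq_bot DF' DERIV_continuous_on[OF DF'])
  moreover have "let \<beta> = 2 * \<alpha> / (1 - \<alpha>) in
      Holder_space (2 + nat \<lfloor>\<beta>\<rfloor>) (\<beta> - of_int \<lfloor>\<beta>\<rfloor>) {0..R} v"
  proof -
    define \<beta> where "\<beta> = 2 * \<alpha> / (1 - \<alpha>)"
    define n where "n = 2 + nat \<lfloor>\<beta>\<rfloor>"
    have "0 < \<beta>" using \<alpha>_pos \<alpha>_less by (simp add: \<beta>_def)
    \<comment> \<open>Both sides are the fractional part, because \<open>p = 2 + \<beta>\<close>;
      positivity of \<beta> ensures that \<open>nat\<close> does not truncate.\<close>
    then have \<beta>_n: "\<beta> - of_int \<lfloor>\<beta>\<rfloor> = p - real n"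
      using \<alpha>_less by (simp add: n_def p_def \<beta>_def field_simps)
    then have n: "real n \<le> p" "p - real n \<le> 1" by linarith+
    have "\<exists>C. \<forall>x\<in>{0..R}. \<forall>y\<in>{0..R}.
        \<bar>(deriv_on {0..R} ^^ n) v x - (deriv_on {0..R} ^^ n) v y\<bar> \<le> C * \<bar>x - y\<bar> powr (p - real n)"
      if "p - real n \<noteq> 0"
    proof -
      from that n obtain C where "0 \<le> C" and C: "\<And>s t. s \<in> {0..\<tau>} \<Longrightarrow> t \<in> {0..\<tau>} \<Longrightarrow>
          \<bar>dU n s - dU n t\<bar> \<le> C * \<bar>s - t\<bar> powr (p - real n)"
        using dU_Holder[of n \<tau>] \<open>0 < \<tau>\<close> by auto
      show ?thesis
      proof (intro exI ballI)
        fix x y assume xy: "x \<in> {0..R}" "y \<in> {0..R}"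
        have "\<bar>F n x - F n y\<bar> = lam * \<mu> ^ n * \<bar>dU n (\<tau> - \<mu> * x) - dU n (\<tau> - \<mu> * y)\<bar>"
          using \<open>0 < lam\<close> \<mu> by (simp add: F_def abs_mult power_abs flip: right_diff_distrib)
        also have "\<dots> \<le> lam * \<mu> ^ n * (C * \<bar>(\<tau> - \<mu> * x) - (\<tau> - \<mu> * y)\<bar> powr (p - real n))"
          using xy arg_nonneg arg_le \<open>0 < lam\<close> \<mu> by (intro mult_left_mono C) auto
        also have "(\<tau> - \<mu> * x) - (\<tau> - \<mu> * y) = \<mu> * (y - x)"
          by (simp add: algebra_simps)
        also have "lam * \<mu> ^ n * (C * \<bar>\<mu> * (y - x)\<bar> powr (p - real n)) =
            lam * \<mu> ^ n * C * \<mu> powr (p - real n) * \<bar>x - y\<bar> powr (p - real n)"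
          using \<mu> by (simp add: abs_mult powr_mult abs_minus_commute)
        finally show "\<bar>(deriv_on {0..R} ^^ n) v x - (deriv_on {0..R} ^^ n) v y\<bar> \<le>
            lam * \<mu> ^ n * C * \<mu> powr (p - real n) * \<bar>x - y\<bar> powr (p - real n)"
          using xy n by (simp add: deriv)
      qed
    qed
    then have "Holder_space n (p - real n) {0..R} v"
      using Ck[OF n(1)] by (simp add: Holder_space_def v)
    then show ?thesis
      unfolding Let_def \<beta>_def[symmetric] n_def[symmetric] \<beta>_n .
  qed
  ultimately show "fb_solution \<alpha> \<Lambda> v0 c R v"
    using R \<open>0 < c\<close> by (simp add: fb_solution_def)
qed

text \<open>Reversing and rescaling the variable turns \<open>w\<close> into a nonnegative solution
  \<open>Z\<close> of the profile problem, that is, \<open>U\<close> after a possible interval of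
  zeros. Smoothness of \<open>w\<close> before \<open>R\<close> makes that interval trivial.\<close>

lemma fb_solution_imp_scaled_U:
  assumes w: "fb_solution \<alpha> \<Lambda> v0 c R w" and "0 < \<Lambda>" "0 < v0"
  obtains lam where "0 < lam" "lam * c\<^sup>2 = \<Lambda> * lam powr \<alpha>"
    "lam * V (c / \<Lambda> * R) = 1 - v0"
    "\<And>\<xi>. \<xi> \<in> {0..R} \<Longrightarrow> w \<xi> = lam * U (c / \<Lambda> * (R - \<xi>))"
proof -
  have c: "0 < c" and R: "0 < R" and Cinf: "Cinf_on {0..<R} w"
    using w by (auto simp: fb_solution_def)
  define \<mu> where "\<mu> = c / \<Lambda>"
  define S where "S = \<mu> * R"
  \<comment> \<open>The positive root of
    \<open>lam * c\<^sup>2 = \<Lambda> * lam powr \<alpha>\<close>.\<close>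
  define lam where "lam = (c\<^sup>2 / \<Lambda>) powr (1 / (\<alpha> - 1))"
  have \<mu>: "0 < \<mu>" using c \<open>0 < \<Lambda>\<close> by (simp add: \<mu>_def)
  have S: "0 < S" using \<mu> R by (simp add: S_def)
  have lam_pos: "0 < lam" using c \<open>0 < \<Lambda>\<close> by (simp add: lam_def)
  have "lam powr (\<alpha> - 1) = c\<^sup>2 / \<Lambda>"
    using c \<open>0 < \<Lambda>\<close> \<alpha>_less by (simp add: lam_def powr_powr)
  then have lam: "lam * c\<^sup>2 = \<Lambda> * lam powr \<alpha>"
    using lam_pos \<open>0 < \<Lambda>\<close> by (simp add: powr_diff field_simps)
  define w' where "w' = deriv_on {0..R} w"
  define w'' where "w'' = deriv_on {0..R} w'"
  have prob: "\<And>\<xi>. \<xi> \<in> {0..R} \<Longrightarrow> 0 \<le> w \<xi>"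
    "\<And>\<xi>. \<xi> \<in> {0<..<R} \<Longrightarrow> \<Lambda> * w'' \<xi> - c * w' \<xi> = w \<xi> powr \<alpha>"
    "w 0 = v0" "w' 0 = - (c / \<Lambda>) * (1 - v0)" "w R = 0" "w' R = 0"
    using w by (auto simp: fb_solution_def fb_problem_def Let_def w'_def w''_def)
  define n where "n = 2 + nat \<lfloor>2 * \<alpha> / (1 - \<alpha>)\<rfloor>"
  have n: "2 \<le> n" "Ck_on n {0..R} w"
    using w by (simp_all add: fb_solution_def Let_def Holder_space_def n_def)
  have cont: "continuous_on {0..R} w" "continuous_on {0..R} w'"
    using Ck_on_continuous[OF n(2), of 0] Ck_on_continuous[OF n(2), of 1] n
    by (auto simp: w'_def)
  have Dw: "(w has_real_derivative w' \<xi>) (at \<xi>)" "(w' has_real_derivative w'' \<xi>) (at \<xi>)"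
    if "\<xi> \<in> {0<..<R}" for \<xi>
  proof -
    have "at \<xi> within {0..R} = at \<xi>"
      using that by (intro at_within_interior) auto
    then show "(w has_real_derivative w' \<xi>) (at \<xi>)" "(w' has_real_derivative w'' \<xi>) (at \<xi>)"
      using Ck_on_DERIV[OF n(2), of 0 \<xi>] Ck_on_DERIV[OF n(2), of 1 \<xi>] n that
      by (auto simp: w'_def w''_def)
  qed
  define Z where "Z s = w (R - s / \<mu>) / lam" for s
  define Z' where "Z' s = w' (R - s / \<mu>) / (- lam * \<mu>)" for s
  have arg: "R - s / \<mu> \<in> {0..R}" if "s \<in> {0..S}" for s
    using that \<mu> by (auto simp: S_def field_simps)
  have arg': "R - s / \<mu> \<in> {0<..<R}" if "s \<in> {0<..<S}" for s
    using that \<mu> by (auto simp: S_def field_simps)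
  have lin: "((\<lambda>s. R - s / \<mu>) has_real_derivative - 1 / \<mu>) (at s)" for s
    using \<mu> by (auto intro!: derivative_eq_intros)
  have "sol S Z Z'"
    unfolding sol_def
  proof (intro conjI ballI)
    show "Z 0 = 0" "Z' 0 = 0" by (simp_all add: Z_def Z'_def prob)
    have "continuous_on {0..S} (\<lambda>s. w (R - s / \<mu>))" "continuous_on {0..S} (\<lambda>s. w' (R - s / \<mu>))"
      using arg \<mu> by (auto intro!: continuous_on_compose2[OF cont(1)]
        continuous_on_compose2[OF cont(2)] continuous_intros)
    then show "continuous_on {0..S} Z" "continuous_on {0..S} Z'"
      unfolding Z_def Z'_def using \<mu> lam_pos by (auto intro!: continuous_intros)
    fix s assume s: "s \<in> {0<..<S}"
    let ?\<xi> = "R - s / \<mu>"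
    have "(Z has_real_derivative w' ?\<xi> * (- 1 / \<mu>) / lam) (at s)"
      unfolding Z_def by (intro DERIV_cdivide DERIV_chain2[OF Dw(1) lin] arg' s)
    then show "(Z has_real_derivative Z' s) (at s)" by (simp add: Z'_def mult.commute)
    have "(Z' has_real_derivative w'' ?\<xi> * (- 1 / \<mu>) / (- lam * \<mu>)) (at s)"
      unfolding Z'_def by (intro DERIV_cdivide DERIV_chain2[OF Dw(2) lin] arg' s)
    moreover have "w'' ?\<xi> * (- 1 / \<mu>) / (- lam * \<mu>) = Z s powr \<alpha> - Z' s"
    proof -
      have "Z s powr \<alpha> = w ?\<xi> powr \<alpha> / lam powr \<alpha>"
        unfolding Z_def by (rule powr_divide)
      also have "\<dots> = (\<Lambda> * w'' ?\<xi> - c * w' ?\<xi>) / (lam * c\<^sup>2 / \<Lambda>)"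
        using prob(2)[OF arg'[OF s]] lam \<open>0 < \<Lambda>\<close> by simp
      finally show ?thesis
        unfolding Z'_def \<mu>_def using \<open>0 < \<Lambda>\<close> c lam_pos
        by (simp add: power2_eq_square field_simps)
    qed
    ultimately show "(Z' has_real_derivative Z s powr \<alpha> - Z' s) (at s)" by simp
  qed
  moreover have "0 \<le> Z s" if "s \<in> {0..S}" for s
    using prob(1)[OF arg[OF that]] lam_pos by (simp add: Z_def)
  moreover have "0 < Z S"
    using \<mu> lam_pos prob(3) \<open>0 < v0\<close> by (simp add: Z_def S_def)
  ultimately obtain s1 where s1: "0 \<le> s1" "s1 < S" and Z_zero: "\<And>s. s \<in> {0..s1} \<Longrightarrow> Z s = 0"
    and Z_eq: "\<And>s. s \<in> {0..S - s1} \<Longrightarrow> Z (s + s1) = U s \<and> Z' (s + s1) = V s"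
    using sol_eq_shifted_U[of S Z Z'] S by metis
  have w_eq: "w \<xi> = lam * Z (\<mu> * (R - \<xi>))" for \<xi>
    using \<mu> lam_pos by (simp add: Z_def)
  have "s1 = 0"
  \<comment> \<open>Otherwise \<open>w\<close> is smooth and identically zero to the right of the
    interior point \<open>x1\<close>, hence flat of every order there, against the power behaviour
    of \<open>U\<close>.\<close>
  proof (rule ccontr)
    assume "s1 \<noteq> 0"
    define x1 where "x1 = R - s1 / \<mu>"
    have x1: "0 < x1" "x1 < R"
      using \<open>s1 \<noteq> 0\<close> s1 \<mu> by (auto simp: x1_def S_def field_simps)
    have zero: "w x = 0" if "x \<in> {x1..<R}" for x
      unfolding w_eq using that \<mu> by (subst Z_zero) (auto simp: x1_def field_simps)
    obtain n where n: "p < real n" using reals_Archimedean2 by blast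
    then have "0 < n" using p_gt_2 by (cases n) auto
    from Cinf_on_flat[OF Cinf x1 zero this]
    obtain C where C: "\<forall>x\<in>{x1 / 2..<x1}. \<bar>w x\<bar> \<le> C * (x1 - x) ^ n"
      by auto
    have "U s \<le> C / (lam * \<mu> ^ n) * s ^ n" if s: "s \<in> {0<..<\<mu> * x1 / 2}" for s
    proof -
      have "s < \<mu> * x1" using s \<mu> x1 by simp
      then have "lam * U s = w (x1 - s / \<mu>)"
        using Z_eq[of s] s \<mu> by (simp add: w_eq x1_def S_def algebra_simps)
      also have "\<dots> \<le> C * (s / \<mu>) ^ n"
        using order_trans[OF abs_ge_self bspec[OF C, of "x1 - s / \<mu>"]] s \<mu> by (simp add: field_simps)
      finally show ?thesis using \<mu> lam_pos by (simp add: field_simps power_divide)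
    qed
    moreover have "0 < \<mu> * x1 / 2" using \<mu> x1 by simp
    ultimately show False using U_not_flat[OF n] by blast
  qed
  show thesis
  proof (rule that[OF lam_pos lam])
    have "Z' S = V S" using Z_eq[of S] \<open>s1 = 0\<close> S by simp
    then have "V S = \<mu> * (1 - v0) / (lam * \<mu>)"
      using prob(4) \<mu> by (simp add: Z'_def S_def \<mu>_def[symmetric])
    then show "lam * V (c / \<Lambda> * R) = 1 - v0"
      using \<mu> lam_pos by (simp add: S_def flip: \<mu>_def)
    fix \<xi> assume "\<xi> \<in> {0..R}"
    then show "w \<xi> = lam * U (c / \<Lambda> * (R - \<xi>))"
      using Z_eq[of "\<mu> * (R - \<xi>)"] \<open>s1 = 0\<close> \<mu> unfolding w_eq by (simp add: S_def flip: \<mu>_def)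
  qed
qed

end

section \<open>Matching the data at the fixed end\<close>

theorem theorem3p1:
  fixes \<alpha> \<Lambda> :: real
  assumes "0 < \<alpha>" and "\<alpha> < 1" and "0 < \<Lambda>"
  shows "\<forall>v0\<in>{0<..<1}. \<exists>c R v.
           fb_solution \<alpha> \<Lambda> v0 c R v \<and>
           (\<forall>c' R' w. fb_solution \<alpha> \<Lambda> v0 c' R' w \<longrightarrow>
              c' = c \<and> R' = R \<and> (\<forall>\<xi>\<in>{0..R}. w \<xi> = v \<xi>)) \<and>
           (\<forall>\<xi>\<in>{0..<R}. 0 < v \<xi> \<and> deriv_on {0..R} v \<xi> < 0 \<and>
              0 < deriv_on {0..R} (deriv_on {0..R} v) \<xi>)"
proof
  interpret sublinear \<alpha> using assms by unfold_locales
  fix v0 :: real assume v0: "v0 \<in> {0<..<1}"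
  define k where "k = (1 - v0) / v0"
  have "0 < k" using v0 by (simp add: k_def)
  then obtain \<tau> where \<tau>: "0 < \<tau>" "V \<tau> / U \<tau> = k" using quotient_surj by blast
  define lam where "lam = v0 / U \<tau>"
  \<comment> \<open>The positive root of
    \<open>lam * c\<^sup>2 = \<Lambda> * lam powr \<alpha>\<close>, solved for \<open>c\<close> with
    \<open>lam\<close> already fixed by the value at 0.\<close>
  define c where "c = sqrt (\<Lambda> * lam powr (\<alpha> - 1))"
  define R where "R = \<tau> / (c / \<Lambda>)"
  define v where "v = (\<lambda>\<xi>. lam * dU 0 (\<tau> - c / \<Lambda> * \<xi>))"
  have lam_pos: "0 < lam" using v0 U_pos[OF \<tau>(1)] by (simp add: lam_def)
  have c_pos: "0 < c" using lam_pos \<open>0 < \<Lambda>\<close> by (simp add: c_def)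
  have lam_c: "lam * c\<^sup>2 = \<Lambda> * lam powr \<alpha>"
    using lam_pos \<open>0 < \<Lambda>\<close> by (simp add: c_def powr_diff field_simps)
  have "lam * U \<tau> = v0" "lam * V \<tau> = 1 - v0"
    using \<tau> U_pos[OF \<tau>(1)] v0 by (auto simp: lam_def k_def field_simps)
  note scaled = fb_solution_scaled_U[OF \<open>0 < \<Lambda>\<close> c_pos lam_pos \<tau>(1) lam_c this]
  have v: "fb_solution \<alpha> \<Lambda> v0 c R v"
    "\<forall>\<xi>\<in>{0..<R}. 0 < v \<xi> \<and> deriv_on {0..R} v \<xi> < 0 \<and>
      0 < deriv_on {0..R} (deriv_on {0..R} v) \<xi>"
    unfolding R_def v_def by (rule scaled)+
  have unique: "c' = c \<and> R' = R \<and> (\<forall>\<xi>\<in>{0..R}. w \<xi> = v \<xi>)" if w: "fb_solution \<alpha> \<Lambda> v0 c' R' w" for c' R' w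
  proof -
    obtain lam' where lam': "0 < lam'" "lam' * c'\<^sup>2 = \<Lambda> * lam' powr \<alpha>"
      and V_eq: "lam' * V (c' / \<Lambda> * R') = 1 - v0"
      and w_eq: "\<And>\<xi>. \<xi> \<in> {0..R'} \<Longrightarrow> w \<xi> = lam' * U (c' / \<Lambda> * (R' - \<xi>))"
      using fb_solution_imp_scaled_U[OF w \<open>0 < \<Lambda>\<close>] v0 by auto
    have pos: "0 < c'" "0 < R'" and "w 0 = v0"
      using w by (auto simp: fb_solution_def fb_problem_def Let_def)
    define S where "S = c' / \<Lambda> * R'"
    have "0 < S" using pos \<open>0 < \<Lambda>\<close> by (simp add: S_def)
    have US: "lam' * U S = v0" using w_eq[of 0] pos \<open>w 0 = v0\<close> by (simp add: S_def)
    \<comment> \<open>The quotient eliminates the unknown scale \<open>lam'\<close>, so strict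
      monotonicity determines \<open>S\<close> first; then \<open>lam'\<close>, \<open>c'\<close>
      and \<open>R'\<close> follow in turn.\<close>
    have "V S / U S = (lam' * V S) / (lam' * U S)" using lam' by simp
    also have "\<dots> = k" using V_eq US by (simp add: k_def S_def)
    finally have "S = \<tau>"
      using quotient_strict_decreasing[of S \<tau>] quotient_strict_decreasing[of \<tau> S] \<tau> \<open>0 < S\<close>
      by (cases S \<tau> rule: linorder_cases) auto
    then have "lam' = lam" using US U_pos[OF \<tau>(1)] by (simp add: lam_def field_simps)
    then have "c'\<^sup>2 = c\<^sup>2" using lam' lam_c by (metis less_irrefl mult_cancel_left)
    then have "c' = c" using pos c_pos by (simp add: power2_eq_iff)
    moreover have "R' = R"
      using \<open>S = \<tau>\<close> \<open>c' = c\<close> c_pos \<open>0 < \<Lambda>\<close> by (simp add: S_def R_def field_simps)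
    moreover have "w \<xi> = v \<xi>" if \<xi>: "\<xi> \<in> {0..R}" for \<xi>
    proof -
      have "c / \<Lambda> * (R - \<xi>) = \<tau> - c / \<Lambda> * \<xi>"
        using c_pos \<open>0 < \<Lambda>\<close> by (simp add: R_def field_simps)
      moreover have "0 \<le> c / \<Lambda> * (R - \<xi>)" using \<xi> c_pos \<open>0 < \<Lambda>\<close> by simp
      ultimately show ?thesis
        using w_eq[of \<xi>] \<xi> \<open>c' = c\<close> \<open>R' = R\<close> \<open>lam' = lam\<close> dU_0 by (simp add: v_def)
    qed
    ultimately show ?thesis by blast
  qed
  from v unique
  show "\<exists>c R v. fb_solution \<alpha> \<Lambda> v0 c R v \<and>
     (\<forall>c' R' w. fb_solution \<alpha> \<Lambda> v0 c' R' w \<longrightarrow>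
        c' = c \<and> R' = R \<and> (\<forall>\<xi>\<in>{0..R}. w \<xi> = v \<xi>)) \<and>
     (\<forall>\<xi>\<in>{0..<R}. 0 < v \<xi> \<and> deriv_on {0..R} v \<xi> < 0 \<and>
        0 < deriv_on {0..R} (deriv_on {0..R} v) \<xi>)"
    by blast
qed

end
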